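(* Let $1<p<\infty$ and let $X=(X,d,\mu)$ be a metric measure space such that $\mu$ is locally doubling and supports a local $p$-Poincaré inequality. If $X$ is bounded, then all quasiharmonic functions on $X$ are locally constant, and thus constant in each component of $X$.
   Context: Throughout, $1<p<\infty$ and $X=(X,d,\mu)$ is a metric space with a positive complete Borel measure $\mu$ such that $0<\mu(B)<\infty$ for all balls $B\subset X$. $X$ need not be complete or locally compact. Balls are open and come with a prescribed centre and radius $r_B$; $\lambda B$ is the concentric ball with radius $\lambda r_B$. Upper gradients. Curves are nonconstant, compact and rectifiable, parameterized by arc length $ds$. A property holds for $p$-almost every curve if for the family $\Gamma$ of curves for which it fails there is a Borel function $0\le\rho\in L^p(X)$ with $\int_\gamma\rho\,ds=\infty$ for all $\gamma\in\Gamma$. A measurable $g:X\to[0,\infty]$ is a $p$-weak upper gradient of $u:X\to[-\infty,\infty]$ if for $p$-almost every curve $\gamma:[0,l_\gamma]\to X$, $|u(\gamma(0))-u(\gamma(l_\gamma))|\le\int_\gamma g\,ds$ (left-hand side $\infty$ if a term is $\pm\infty$). If $u$ has a $p$-weak upper gradient in $L^p_{\rm loc}$, then $g_u$ denotes the minimal one (a.e. smallest). For measurable $u$, $\|u\|_{N^{1,p}(X)}^p=\int_X|u|^p\,d\mu+\inf_g\int_Xg^p\,d\mu$, infimum over $p$-weak upper gradients $g$ of $u$, and $N^{1,p}(X)=\{u:\|u\|_{N^{1,p}(X)}<\infty\}$ (functions defined everywhere); $N^{1,p}(E)$ is defined by regarding a measurable set $E$ as a metric measure space in its own right. Local assumptions.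 $\mu$ is locally doubling if for every $x_0\in X$ there are $r_0>0$, $C>0$ (depending on $x_0$) with $\mu(2B)\le C\mu(B)$ for all balls $B\subset B(x_0,r_0)$. $\mu$ supports a local $p$-Poincaré inequality if for every $x_0\in X$ there are $r_0>0$, $C>0$, $\lambda\ge1$ (depending on $x_0$) such that for all balls $B\subset B(x_0,r_0)$, all integrable $u$ on $\lambda B$ and all $p$-weak upper gradients $g$ of $u$, $\frac1{\mu(B)}\int_B|u-u_B|\,d\mu\le Cr_B\bigl(\frac1{\mu(\lambda B)}\int_{\lambda B}g^p\,d\mu\bigr)^{1/p}$, where $u_B=\frac1{\mu(B)}\int_Bu\,d\mu$. Quasiharmonic functions on $X$. A function $u$ on $X$ with $u\in N^{1,p}(G)$ for every bounded open $G\subset X$ is a quasiminimizer on $X$ if there is $Q\ge1$ with $\int_{\{\varphi\ne0\}}g_u^p\,d\mu\le Q\int_{\{\varphi\ne0\}}g_{u+\varphi}^p\,d\mu$ for all $\varphi$ in the closure in $N^{1,p}(X)$ of the functions in $N^{1,p}(X)$ vanishing outside some bounded open set. (Bounded open sets include $X$ itself when $X$ is bounded.) A continuous (real-valued) quasiminimizer is called quasiharmonic. *)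

theory Defs
  imports "HOL-Analysis.Analysis"
begin

text \<open>
  The metric space \<open>X\<close> is a type of class \<open>metric_space\<close>. The notions that are also needed on a subset
  regarded as a metric measure space in its own right carry the subset \<open>E\<close> as a parameter;
  functions are total on the type, but only their values on \<open>E\<close> matter.
\<close>

definition epow :: "ennreal \<Rightarrow> real \<Rightarrow> ennreal" where
  "epow x q = (if x = \<infinity> then \<infinity> else ennreal (enn2real x powr q))"

text \<open>
  A complete Borel measure is the completion of a measure on the Borel sigma-algebra.
\<close>

definition metric_measure :: "'a::metric_space measure \<Rightarrow> bool" where
  "metric_measure \<mu> \<longleftrightarrow>
     (\<exists>\<nu>. sets \<nu> = sets borel \<and> \<mu> = completion \<nu>) \<and>
     (\<forall>x r. 0 < r \<longrightarrow> 0 < emeasure \<mu> (ball x r) \<and> emeasure \<mu> (ball x r) < \<infinity>)"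

definition curve_length :: "(real \<Rightarrow> 'a::metric_space) \<Rightarrow> real \<Rightarrow> real \<Rightarrow> ennreal" where
  "curve_length \<gamma> a b =
     (SUP ts \<in> {ts. sorted ts \<and> set ts \<subseteq> {a..b}}.
        \<Sum>i<length ts - 1. ennreal (dist (\<gamma> (ts ! i)) (\<gamma> (ts ! Suc i))))"

text \<open>
  Nonconstant, compact, rectifiable curves in \<open>E\<close>, parameterized by arc length. The equation for
  the length makes \<open>\<gamma>\<close> 1-Lipschitz, hence continuous, and \<open>0 < l\<close> excludes the constant curves.
\<close>

definition arc_length_curve :: "'a::metric_space set \<Rightarrow> (real \<Rightarrow> 'a) \<Rightarrow> real \<Rightarrow> bool" where
  "arc_length_curve E \<gamma> l \<longleftrightarrow>
     0 < l \<and> \<gamma> ` {0..l} \<subseteq> E \<and>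
     (\<forall>s t. 0 \<le> s \<and> s \<le> t \<and> t \<le> l \<longrightarrow> curve_length \<gamma> s t = ennreal (t - s))"

text \<open>
  For functions that are not measurable along \<open>\<gamma>\<close> this is a lower integral. If \<open>g\<close> is measurable
  on the space, this affects only a negligible family of curves.
\<close>

definition curve_integral :: "('a \<Rightarrow> ennreal) \<Rightarrow> (real \<Rightarrow> 'a) \<Rightarrow> real \<Rightarrow> ennreal" where
  "curve_integral g \<gamma> l = (\<integral>\<^sup>+t\<in>{0..l}. g (\<gamma> t) \<partial>lebesgue)"

definition ae_curve ::
  "'a::metric_space measure \<Rightarrow> real \<Rightarrow> 'a set \<Rightarrow> ((real \<Rightarrow> 'a) \<Rightarrow> real \<Rightarrow> bool) \<Rightarrow> bool" where
  "ae_curve \<mu> p E P \<longleftrightarrow>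
     (\<exists>\<rho>. \<rho> \<in> borel_measurable (restrict_space borel E) \<and>
          (\<integral>\<^sup>+x. epow (\<rho> x) p \<partial>restrict_space \<mu> E) < \<infinity> \<and>
          (\<forall>\<gamma> l. arc_length_curve E \<gamma> l \<and> \<not> P \<gamma> l \<longrightarrow> curve_integral \<rho> \<gamma> l = \<infinity>))"

definition weak_upper_gradient ::
  "'a::metric_space measure \<Rightarrow> real \<Rightarrow> 'a set \<Rightarrow> ('a \<Rightarrow> ereal) \<Rightarrow> ('a \<Rightarrow> ennreal) \<Rightarrow> bool" where
  "weak_upper_gradient \<mu> p E u g \<longleftrightarrow>
     g \<in> borel_measurable (restrict_space \<mu> E) \<and>
     ae_curve \<mu> p E (\<lambda>\<gamma> l.
       (if \<bar>u (\<gamma> 0)\<bar> = \<infinity> \<or> \<bar>u (\<gamma> l)\<bar> = \<infinity> then \<infinity> else e2ennreal \<bar>u (\<gamma> 0) - u (\<gamma> l)\<bar>)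
         \<le> curve_integral g \<gamma> l)"

definition Lp_loc :: "'a::metric_space measure \<Rightarrow> real \<Rightarrow> ('a \<Rightarrow> ennreal) set" where
  "Lp_loc \<mu> p = {g \<in> borel_measurable \<mu>.
     \<forall>x. \<exists>r>0. (\<integral>\<^sup>+y\<in>ball x r. epow (g y) p \<partial>\<mu>) < \<infinity>}"

definition is_minimal_weak_upper_gradient ::
  "'a::metric_space measure \<Rightarrow> real \<Rightarrow> ('a \<Rightarrow> ereal) \<Rightarrow> ('a \<Rightarrow> ennreal) \<Rightarrow> bool" where
  "is_minimal_weak_upper_gradient \<mu> p u g \<longleftrightarrow>
     weak_upper_gradient \<mu> p UNIV u g \<and> g \<in> Lp_loc \<mu> p \<and>
     (\<forall>h. weak_upper_gradient \<mu> p UNIV u h \<and> h \<in> Lp_loc \<mu> p \<longrightarrow> (AE x in \<mu>. g x \<le> h x))"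

text \<open>
  The minimal \<open>p\<close>-weak upper gradient \<open>g\<^sub>u\<close> is unique only up to null sets.
\<close>

definition minimal_weak_upper_gradient ::
  "'a::metric_space measure \<Rightarrow> real \<Rightarrow> ('a \<Rightarrow> ereal) \<Rightarrow> 'a \<Rightarrow> ennreal" where
  "minimal_weak_upper_gradient \<mu> p u = (SOME g. is_minimal_weak_upper_gradient \<mu> p u g)"

definition newton_norm ::
  "'a::metric_space measure \<Rightarrow> real \<Rightarrow> 'a set \<Rightarrow> ('a \<Rightarrow> ereal) \<Rightarrow> ennreal" where
  "newton_norm \<mu> p E u =
     epow ((\<integral>\<^sup>+x. epow (e2ennreal \<bar>u x\<bar>) p \<partial>restrict_space \<mu> E) +
           (INF g \<in> {g. weak_upper_gradient \<mu> p E u g}. \<integral>\<^sup>+x. epow (g x) p \<partial>restrict_space \<mu> E))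
          (1 / p)"

definition newton_space ::
  "'a::metric_space measure \<Rightarrow> real \<Rightarrow> 'a set \<Rightarrow> ('a \<Rightarrow> ereal) set" where
  "newton_space \<mu> p E =
     {u \<in> borel_measurable (restrict_space \<mu> E). newton_norm \<mu> p E u < \<infinity>}"

definition locally_doubling :: "'a::metric_space measure \<Rightarrow> bool" where
  "locally_doubling \<mu> \<longleftrightarrow>
     (\<forall>x0. \<exists>r0>0. \<exists>C>0. \<forall>x r. 0 < r \<and> ball x r \<subseteq> ball x0 r0 \<longrightarrow>
        emeasure \<mu> (ball x (2 * r)) \<le> ennreal C * emeasure \<mu> (ball x r))"

text \<open>
  An integrable function is finite almost everywhere, so \<open>real_of_ereal\<close> does not change its mean value.
\<close>

definition mean_value :: "'a measure \<Rightarrow> 'a set \<Rightarrow> ('a \<Rightarrow> ereal) \<Rightarrow> real" where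
  "mean_value \<mu> B u = (LINT x:B|\<mu>. real_of_ereal (u x)) / measure \<mu> B"

definition local_Poincare :: "'a::metric_space measure \<Rightarrow> real \<Rightarrow> bool" where
  "local_Poincare \<mu> p \<longleftrightarrow>
     (\<forall>x0. \<exists>r0>0. \<exists>C>0. \<exists>\<Lambda>\<ge>1. \<forall>x r u g.
        0 < r \<and> ball x r \<subseteq> ball x0 r0 \<and>
        u \<in> borel_measurable (restrict_space \<mu> (ball x (\<Lambda> * r))) \<and>
        (\<integral>\<^sup>+y\<in>ball x (\<Lambda> * r). e2ennreal \<bar>u y\<bar> \<partial>\<mu>) < \<infinity> \<and>
        weak_upper_gradient \<mu> p (ball x (\<Lambda> * r)) u g \<longrightarrow>
        (\<integral>\<^sup>+y\<in>ball x r. e2ennreal \<bar>u y - ereal (mean_value \<mu> (ball x r) u)\<bar> \<partial>\<mu>)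
            / emeasure \<mu> (ball x r)
          \<le> ennreal (C * r) *
            epow ((\<integral>\<^sup>+y\<in>ball x (\<Lambda> * r). epow (g y) p \<partial>\<mu>) / emeasure \<mu> (ball x (\<Lambda> * r))) (1 / p))"

definition bounded_support_newton ::
  "'a::metric_space measure \<Rightarrow> real \<Rightarrow> ('a \<Rightarrow> ereal) set" where
  "bounded_support_newton \<mu> p =
     {\<psi> \<in> newton_space \<mu> p UNIV. \<exists>G. open G \<and> bounded G \<and> (\<forall>x. x \<notin> G \<longrightarrow> \<psi> x = 0)}"

text \<open>
  Differences and sums of functions in \<open>N\<^sup>1\<^sup>,\<^sup>p\<close> are formed pointwise in \<open>ereal\<close>. The set where
  such an expression reads \<open>\<infinity> - \<infinity>\<close> is null and is met by almost no curve.
\<close>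

definition test_functions :: "'a::metric_space measure \<Rightarrow> real \<Rightarrow> ('a \<Rightarrow> ereal) set" where
  "test_functions \<mu> p =
     {\<phi> \<in> newton_space \<mu> p UNIV.
        \<forall>\<epsilon>>0. \<exists>\<psi>\<in>bounded_support_newton \<mu> p. newton_norm \<mu> p UNIV (\<lambda>x. \<phi> x - \<psi> x) < ennreal \<epsilon>}"

definition quasiminimizer :: "'a::metric_space measure \<Rightarrow> real \<Rightarrow> ('a \<Rightarrow> ereal) \<Rightarrow> bool" where
  "quasiminimizer \<mu> p u \<longleftrightarrow>
     (\<forall>G. open G \<and> bounded G \<longrightarrow> u \<in> newton_space \<mu> p G) \<and>
     (\<exists>Q\<ge>1. \<forall>\<phi>\<in>test_functions \<mu> p.
        (\<integral>\<^sup>+x\<in>{x. \<phi> x \<noteq> 0}. epow (minimal_weak_upper_gradient \<mu> p u x) p \<partial>\<mu>)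
          \<le> ennreal Q *
            (\<integral>\<^sup>+x\<in>{x. \<phi> x \<noteq> 0}.
               epow (minimal_weak_upper_gradient \<mu> p (\<lambda>y. u y + \<phi> y) x) p \<partial>\<mu>))"

definition quasiharmonic :: "'a::metric_space measure \<Rightarrow> real \<Rightarrow> ('a \<Rightarrow> real) \<Rightarrow> bool" where
  "quasiharmonic \<mu> p u \<longleftrightarrow>
     continuous_on UNIV u \<and> quasiminimizer \<mu> p (\<lambda>x. ereal (u x))"

definition locally_constant :: "('a::topological_space \<Rightarrow> 'b) \<Rightarrow> bool" where
  "locally_constant u \<longleftrightarrow> (\<forall>x. \<exists>U. open U \<and> x \<in> U \<and> u constant_on U)"

end

theory Submission
  imports Defs
begin

text \<open>
  On a bounded space every function vanishes outside the bounded open set \<open>X\<close>, so a quasiminimizer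
  \<open>u\<close> may be tested with \<open>\<phi> = c - u\<close> for any constant \<open>c\<close>; this is in \<open>N\<^sup>1\<^sup>,\<^sup>p\<close> because \<open>X\<close> is
  a ball and hence of finite measure. As \<open>u + \<phi>\<close> is the constant \<open>c\<close>, its minimal weak upper gradient
  is zero, and quasiminimality forces \<open>g\<^sub>u = 0\<close> almost everywhere on \<open>{u \<noteq> c}\<close>. Two different values
  of \<open>c\<close> give \<open>g\<^sub>u = 0\<close> almost everywhere (\<open>quasiminimizer_gradient_zero\<close>). The local Poincare
  inequality then makes \<open>u\<close> almost everywhere equal to its mean on small balls; by continuity, and since
  balls have positive measure, \<open>u\<close> is constant there (\<open>local_Poincare_gradient_zero\<close>).
  
  The argument uses \<open>g\<^sub>u\<close> as an actual weak upper gradient of \<open>u\<close>, and \<open>g\<^sub>u\<close> is given by a choice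
  operator, so the bulk of the work is the existence of a minimal weak upper gradient
  (\<open>ex_minimal_weak_upper_gradient\<close>). It is the limit of a decreasing sequence of Borel
  weak upper gradients whose energies tend to the least possible value. Two closure
  properties are needed. Under decreasing limits (\<open>weak_upper_gradient_INF\<close>) monotone convergence along
  almost every curve suffices. Under minima (\<open>weak_upper_gradient_min\<close>) the point is one-dimensional:
  an increment bounded on all subintervals by the integrals of \<open>g\<^sub>1\<close> and of \<open>g\<^sub>2\<close> is bounded by the integral
  of their minimum (\<open>integrals_bound_min\<close>); the lemma of Henstock gives this without differentiating.
  
  Competitors for \<open>g\<^sub>u\<close> are only locally in \<open>L\<^sup>p\<close>. To know that their integrals along almost every curve
  are finite, \<open>X\<close> is covered by countably many balls on which they are \<open>p\<close>-integrable; such a cover exists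
  because a space of finite measure whose balls have positive measure is separable
  (\<open>finite_measure_countable_dense\<close>).
\<close>

section \<open>Increments bounded by two integrals\<close>

text \<open>
  If \<open>f\<close> were known to be differentiable almost everywhere, both bounds would pass to \<open>\<bar>f'\<bar>\<close>. The lemma
  of Henstock replaces differentiation: on a fine enough tagged division, the integral of each \<open>g\<^sub>i\<close>
  over a cell is close to its value at the tag times the length, with a small total error. On each cell
  the bound by the function that is smaller at the tag is used, and the sum of these bounds is close to
  a Riemann sum of the minimum.
\<close>

lemma integrals_bound_min:
  fixes f g1 g2 :: "real \<Rightarrow> real"
  assumes "a \<le> b"
    and g1: "g1 integrable_on {a..b}" and g2: "g2 integrable_on {a..b}"
    and m: "(\<lambda>t. min (g1 t) (g2 t)) integrable_on {a..b}"
    and b1: "\<And>s t. a \<le> s \<Longrightarrow> s \<le> t \<Longrightarrow> t \<le> b \<Longrightarrow> \<bar>f t - f s\<bar> \<le> integral {s..t} g1"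
    and b2: "\<And>s t. a \<le> s \<Longrightarrow> s \<le> t \<Longrightarrow> t \<le> b \<Longrightarrow> \<bar>f t - f s\<bar> \<le> integral {s..t} g2"
  shows "\<bar>f b - f a\<bar> \<le> integral {a..b} (\<lambda>t. min (g1 t) (g2 t))"
proof (rule field_le_epsilon)
  fix e :: real assume "e > 0"
  let ?m = "\<lambda>t. min (g1 t) (g2 t)"
  have e3: "e / 3 > 0" using \<open>e > 0\<close> by simp
  obtain d1 where d1: "gauge d1" "\<And>p. p tagged_partial_division_of (cbox a b) \<Longrightarrow> d1 fine p \<Longrightarrow>
      (\<Sum>(x,k)\<in>p. norm (measure lborel k *\<^sub>R g1 x - integral k g1)) < e / 3"
    using Henstock_lemma[of g1 a b, OF _ e3] g1 by (auto simp: box_real)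
  obtain d2 where d2: "gauge d2" "\<And>p. p tagged_partial_division_of (cbox a b) \<Longrightarrow> d2 fine p \<Longrightarrow>
      (\<Sum>(x,k)\<in>p. norm (measure lborel k *\<^sub>R g2 x - integral k g2)) < e / 3"
    using Henstock_lemma[of g2 a b, OF _ e3] g2 by (auto simp: box_real)
  obtain d3 where d3: "gauge d3" "\<And>p. p tagged_partial_division_of (cbox a b) \<Longrightarrow> d3 fine p \<Longrightarrow>
      (\<Sum>(x,k)\<in>p. norm (measure lborel k *\<^sub>R ?m x - integral k ?m)) < e / 3"
    using Henstock_lemma[of ?m a b, OF _ e3] m by (auto simp: box_real)
  have "gauge (\<lambda>x. (d1 x \<inter> d2 x) \<inter> d3 x)"
    using d1(1) d2(1) d3(1) by (intro gauge_Int)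
  then obtain p where p: "p tagged_division_of {a..b}" and fine: "(\<lambda>x. (d1 x \<inter> d2 x) \<inter> d3 x) fine p"
    by (rule fine_division_exists_real)
  have "d1 fine p" "d2 fine p" "d3 fine p"
    using fine by (auto simp: fine_Int)
  have pp: "p tagged_partial_division_of (cbox a b)"
    using p by (simp add: tagged_division_of_def box_real)
  have fin: "finite p" using p by blast
  have s1: "(\<Sum>(x,k)\<in>p. norm (measure lborel k *\<^sub>R g1 x - integral k g1)) < e / 3"
    by (rule d1) fact+
  have s2: "(\<Sum>(x,k)\<in>p. norm (measure lborel k *\<^sub>R g2 x - integral k g2)) < e / 3"
    by (rule d2) fact+
  have s3: "(\<Sum>(x,k)\<in>p. norm (measure lborel k *\<^sub>R ?m x - integral k ?m)) < e / 3"
    by (rule d3) fact+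
  have I: "(\<Sum>(x,k)\<in>p. integral k ?m) = integral {a..b} ?m"
    using integral_combine_tagged_division_topdown[of ?m a b p] m p by (simp add: box_real)
  have "\<bar>f b - f a\<bar> = \<bar>\<Sum>(x,k)\<in>p. f (Sup k) - f (Inf k)\<bar>"
    using additive_tagged_division_1[OF \<open>a \<le> b\<close> p, of f] by simp
  also have "\<dots> \<le> (\<Sum>(x,k)\<in>p. \<bar>f (Sup k) - f (Inf k)\<bar>)"
    by (rule order_trans[OF sum_abs]) (simp add: case_prod_unfold)
  also have "\<dots> \<le> (\<Sum>(x,k)\<in>p. norm (measure lborel k *\<^sub>R g1 x - integral k g1)
      + norm (measure lborel k *\<^sub>R g2 x - integral k g2)
      + norm (measure lborel k *\<^sub>R ?m x - integral k ?m) + integral k ?m)"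
  proof (rule sum_mono, clarify)
    fix x k assume xk: "(x, k) \<in> p"
    obtain s t where k: "k = {s..t}" using tagged_division_ofD(4)[OF p xk] by (auto simp: box_real)
    have "x \<in> k" using tagged_division_ofD(2)[OF p xk] .
    then have st: "s \<le> t" using k by auto
    have "k \<subseteq> {a..b}" using tagged_division_ofD(3)[OF p xk] .
    then have ab: "a \<le> s" "t \<le> b" using st k by auto
    have F: "\<bar>f (Sup k) - f (Inf k)\<bar> \<le> integral k g1" "\<bar>f (Sup k) - f (Inf k)\<bar> \<le> integral k g2"
      using b1[OF ab(1) st ab(2)] b2[OF ab(1) st ab(2)] st k by auto
    show "\<bar>f (Sup k) - f (Inf k)\<bar> \<le> norm (measure lborel k *\<^sub>R g1 x - integral k g1)
      + norm (measure lborel k *\<^sub>R g2 x - integral k g2)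
      + norm (measure lborel k *\<^sub>R ?m x - integral k ?m) + integral k ?m"
    proof (cases "g1 x \<le> g2 x")
      case True
      then have m: "?m x = g1 x" by simp
      show ?thesis using F(1) unfolding m real_norm_def real_scaleR_def by linarith
    next
      case False
      then have m: "?m x = g2 x" by simp
      show ?thesis using F(2) unfolding m real_norm_def real_scaleR_def by linarith
    qed
  qed
  also have "\<dots> = (\<Sum>(x,k)\<in>p. norm (measure lborel k *\<^sub>R g1 x - integral k g1))
      + (\<Sum>(x,k)\<in>p. norm (measure lborel k *\<^sub>R g2 x - integral k g2))
      + (\<Sum>(x,k)\<in>p. norm (measure lborel k *\<^sub>R ?m x - integral k ?m)) + (\<Sum>(x,k)\<in>p. integral k ?m)"
    by (simp only: case_prod_unfold sum.distrib)
  also have "\<dots> \<le> integral {a..b} ?m + e"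
    using s1 s2 s3 I by linarith
  finally show "\<bar>f b - f a\<bar> \<le> integral {a..b} ?m + e" .
qed

text \<open>
  The version for extended-valued integrands, which may be replaced by their real parts since they are
  finite almost everywhere.
\<close>

lemma nn_integrals_bound_min:
  fixes f :: "real \<Rightarrow> real" and g1 g2 :: "real \<Rightarrow> ennreal"
  assumes "a \<le> b"
    and [measurable]: "g1 \<in> borel_measurable borel" "g2 \<in> borel_measurable borel"
    and fin: "(\<integral>\<^sup>+t. g1 t \<partial>lborel) < \<infinity>" "(\<integral>\<^sup>+t. g2 t \<partial>lborel) < \<infinity>"
    and bd1: "\<And>s t. a \<le> s \<Longrightarrow> s < t \<Longrightarrow> t \<le> b \<Longrightarrow>
      ennreal \<bar>f t - f s\<bar> \<le> (\<integral>\<^sup>+x\<in>{s..t}. g1 x \<partial>lborel)"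
    and bd2: "\<And>s t. a \<le> s \<Longrightarrow> s < t \<Longrightarrow> t \<le> b \<Longrightarrow>
      ennreal \<bar>f t - f s\<bar> \<le> (\<integral>\<^sup>+x\<in>{s..t}. g2 x \<partial>lborel)"
  shows "ennreal \<bar>f b - f a\<bar> \<le> (\<integral>\<^sup>+x\<in>{a..b}. min (g1 x) (g2 x) \<partial>lborel)"
proof -
  have key: "(\<lambda>x. enn2real (g x)) integrable_on {s..t} \<and>
      (\<integral>\<^sup>+x\<in>{s..t}. g x \<partial>lborel) = ennreal (integral {s..t} (\<lambda>x. enn2real (g x)))"
    if [measurable]: "g \<in> borel_measurable borel" and fg: "(\<integral>\<^sup>+t. g t \<partial>lborel) < \<infinity>"
    for g :: "real \<Rightarrow> ennreal" and s t
  proof -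
    have "AE x in lborel. g x \<noteq> \<infinity>"
      using fg by (intro nn_integral_PInf_AE) auto
    then have ae: "AE x in lborel. ennreal (enn2real (g x)) = g x"
      by eventually_elim (auto simp: top.not_eq_extremum)
    have "(\<integral>\<^sup>+x. ennreal (enn2real (g x)) \<partial>lborel) < \<infinity>"
      using fg nn_integral_cong_AE[OF ae] by simp
    then have "(\<lambda>x. enn2real (g x)) integrable_on UNIV"
      by (intro nn_integral_integrable_on) auto
    then have int: "(\<lambda>x. enn2real (g x)) integrable_on {s..t}"
      using integrable_on_subcbox[of "\<lambda>x. enn2real (g x)" UNIV s t] by (simp add: box_real)
    have "(\<integral>\<^sup>+x\<in>{s..t}. g x \<partial>lborel) = (\<integral>\<^sup>+x\<in>{s..t}. ennreal (enn2real (g x)) \<partial>lborel)"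
      by (rule nn_integral_cong_AE) (use ae in eventually_elim, simp)
    also have "\<dots> = ennreal (integral {s..t} (\<lambda>x. enn2real (g x)))"
      using nn_integral_has_integral_lebesgue'[OF _ integrable_integral[OF int]] by simp
    finally show ?thesis using int by simp
  qed
  let ?m = "\<lambda>x. min (g1 x) (g2 x)"
  have finm: "(\<integral>\<^sup>+t. ?m t \<partial>lborel) < \<infinity>"
    using fin(1) by (rule le_less_trans[rotated]) (auto intro!: nn_integral_mono)
  have "AE x in lborel. g1 x \<noteq> \<infinity>" "AE x in lborel. g2 x \<noteq> \<infinity>"
    using nn_integral_PInf_AE[of g1 lborel] nn_integral_PInf_AE[of g2 lborel] fin by auto
  then have ae: "AE x in lborel. min (enn2real (g1 x)) (enn2real (g2 x)) = enn2real (?m x)"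
    by eventually_elim (auto simp: min_def top.not_eq_extremum enn2real_le_iff intro!: antisym enn2real_mono)
  then obtain N where N: "N \<in> null_sets lborel"
      "{x. min (enn2real (g1 x)) (enn2real (g2 x)) \<noteq> enn2real (?m x)} \<subseteq> N"
    by (auto elim!: AE_E simp: null_sets_def)
  have neg: "negligible N"
    using N(1) by (simp add: negligible_iff_null_sets null_sets_completionI)
  have intm: "(\<lambda>x. enn2real (?m x)) integrable_on {a..b}"
    using key[OF _ finm] by auto
  have im: "(\<lambda>x. min (enn2real (g1 x)) (enn2real (g2 x))) integrable_on {a..b}"
    by (rule integrable_spike[OF intm neg]) (use N(2) in force)
  have eq: "integral {a..b} (\<lambda>x. min (enn2real (g1 x)) (enn2real (g2 x)))
      = integral {a..b} (\<lambda>x. enn2real (?m x))"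
    by (rule integral_spike[OF neg]) (use N(2) in force)
  have b: "\<bar>f t - f s\<bar> \<le> integral {s..t} (\<lambda>x. enn2real (g x))"
    if "a \<le> s" "s \<le> t" "t \<le> b" and g: "g \<in> borel_measurable borel" "(\<integral>\<^sup>+t. g t \<partial>lborel) < \<infinity>"
      and bd: "\<And>s t. a \<le> s \<Longrightarrow> s < t \<Longrightarrow> t \<le> b \<Longrightarrow>
        ennreal \<bar>f t - f s\<bar> \<le> (\<integral>\<^sup>+x\<in>{s..t}. g x \<partial>lborel)" for s t g
  proof (cases "s = t")
    case False
    then have "ennreal \<bar>f t - f s\<bar> \<le> (\<integral>\<^sup>+x\<in>{s..t}. g x \<partial>lborel)"
      using that by auto
    also have "\<dots> = ennreal (integral {s..t} (\<lambda>x. enn2real (g x)))"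
      using key[OF g] by simp
    finally show ?thesis
      by (subst (asm) ennreal_le_iff) (auto intro!: integral_nonneg key[OF g, THEN conjunct1])
  qed simp
  have "\<bar>f b - f a\<bar> \<le> integral {a..b} (\<lambda>x. min (enn2real (g1 x)) (enn2real (g2 x)))"
    using \<open>a \<le> b\<close> key[OF _ fin(1)] key[OF _ fin(2)] im b[OF _ _ _ _ fin(1) bd1] b[OF _ _ _ _ fin(2) bd2]
    by (intro integrals_bound_min) auto
  then show ?thesis
    using key[OF _ finm, of a b] eq by (simp add: ennreal_leI)
qed

section \<open>Powers of extended nonnegative numbers\<close>

lemma epow_0 [simp]: "epow 0 q = 0"
  by (simp add: epow_def)

lemma epow_top [simp]: "epow top q = top"
  by (simp add: epow_def)

lemma epow_ennreal: "0 \<le> x \<Longrightarrow> epow (ennreal x) q = ennreal (x powr q)"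
  by (simp add: epow_def)

lemma epow_mono: "x \<le> y \<Longrightarrow> 0 \<le> q \<Longrightarrow> epow x q \<le> epow y q"
  by (cases x; cases y) (auto simp: epow_ennreal top_unique intro!: ennreal_leI powr_mono2)

lemma epow_epow: "epow (epow x q) r = epow x (q * r)"
  by (cases x) (auto simp: epow_ennreal powr_powr)

lemma epow_1 [simp]: "epow x 1 = x"
  by (cases x) (auto simp: epow_ennreal)

lemma epow_mult: "0 < c \<Longrightarrow> epow (ennreal c * x) q = epow (ennreal c) q * epow x q"
  by (cases x) (auto simp: epow_ennreal powr_mult ennreal_mult_top ennreal_mult[symmetric])

lemma epow_less_top_iff: "epow x q < top \<longleftrightarrow> x < top"
  by (cases x) (auto simp: epow_ennreal)

lemma epow_eq_0_iff: "epow x q = 0 \<longleftrightarrow> x = 0"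
  by (cases x) (auto simp: epow_ennreal)

lemma epow_le_iff: "epow x q \<le> epow y q \<longleftrightarrow> x \<le> y" if "0 < q"
proof
  assume "epow x q \<le> epow y q"
  then have "epow (epow x q) (1 / q) \<le> epow (epow y q) (1 / q)"
    by (rule epow_mono) (use that in auto)
  then show "x \<le> y" using that by (simp add: epow_epow)
qed (use that in \<open>auto intro: epow_mono\<close>)

lemma epow_measurable [measurable]:
  assumes [measurable]: "g \<in> borel_measurable M"
  shows "(\<lambda>x. epow (g x) q) \<in> borel_measurable M"
  unfolding epow_def by measurable

text \<open>
  Countably many \<open>p\<close>-integrable weights are combined below by a supremum. This estimate then does
  the work of the triangle inequality in \<open>L\<^sup>p\<close>.
\<close>

lemma epow_SUP_le_suminf:
  fixes f :: "nat \<Rightarrow> ennreal"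
  assumes "0 < q"
  shows "epow (SUP n. f n) q \<le> (\<Sum>n. epow (f n) q)"
proof -
  let ?S = "\<Sum>n. epow (f n) q"
  have "(SUP n. f n) \<le> epow ?S (1 / q)"
  proof (rule SUP_least)
    fix n
    have "epow (f n) q \<le> ?S"
      using sum_le_suminf[of "\<lambda>n. epow (f n) q" "{n}"] by simp
    then have "epow (epow (f n) q) (1 / q) \<le> epow ?S (1 / q)"
      using assms by (intro epow_mono) auto
    then show "f n \<le> epow ?S (1 / q)"
      using assms by (simp add: epow_epow)
  qed
  then have "epow (SUP n. f n) q \<le> epow (epow ?S (1 / q)) q"
    using assms by (intro epow_mono) auto
  then show ?thesis
    using assms by (simp add: epow_epow)
qed

section \<open>Curves parameterized by arc length\<close>

lemma arc_length_curve_dist_le: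
  assumes "arc_length_curve E \<gamma> l" "0 \<le> s" "s \<le> t" "t \<le> l"
  shows "dist (\<gamma> s) (\<gamma> t) \<le> t - s"
proof -
  have "ennreal (dist (\<gamma> s) (\<gamma> t)) \<le> curve_length \<gamma> s t"
    unfolding curve_length_def
    by (rule SUP_upper2[of "[s, t]"]) (use assms in auto)
  then show ?thesis
    using assms by (simp add: arc_length_curve_def)
qed

lemma arc_length_curve_continuous:
  assumes "arc_length_curve E \<gamma> l"
  shows "continuous_on {0..l} \<gamma>"
proof (rule lipschitz_on_continuous_on)
  show "1-lipschitz_on {0..l} \<gamma>"
  proof (rule lipschitz_onI)
    fix s t assume "s \<in> {0..l}" "t \<in> {0..l}"
    then show "dist (\<gamma> s) (\<gamma> t) \<le> 1 * dist s t"
      using arc_length_curve_dist_le[OF assms, of s t] arc_length_curve_dist_le[OF assms, of t s]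
      by (cases "s \<le> t") (auto simp: dist_real_def dist_commute)
  qed simp
qed

lemma curve_length_shift: "curve_length (\<lambda>x. \<gamma> (c + x)) a b = curve_length \<gamma> (c + a) (c + b)"
proof -
  have *: "curve_length (\<lambda>x. \<gamma> (c + x)) a b \<le> curve_length \<gamma> (c + a) (c + b)" for \<gamma> :: "real \<Rightarrow> 'a" and c a b
    unfolding curve_length_def
  proof (rule SUP_least)
    fix ts assume "ts \<in> {ts. sorted ts \<and> set ts \<subseteq> {a..b}}"
    then show "(\<Sum>i<length ts - 1. ennreal (dist (\<gamma> (c + ts ! i)) (\<gamma> (c + ts ! Suc i))))
      \<le> (SUP ts \<in> {ts. sorted ts \<and> set ts \<subseteq> {c + a..c + b}}.
        \<Sum>i<length ts - 1. ennreal (dist (\<gamma> (ts ! i)) (\<gamma> (ts ! Suc i))))"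
      by (intro SUP_upper2[of "map ((+) c) ts"] sum_mono) (auto simp: sorted_map_same[of id] sorted_wrt_map sorted_iff_nth_mono)
  qed
  show ?thesis
    using *[of \<gamma> c a b] *[of "\<lambda>x. \<gamma> (c + x)" "- c" "c + a" "c + b"] by (intro antisym) auto
qed

lemma arc_length_curve_subcurve:
  assumes "arc_length_curve E \<gamma> l" "0 \<le> s" "s < t" "t \<le> l"
  shows "arc_length_curve E (\<lambda>x. \<gamma> (s + x)) (t - s)"
  using assms unfolding arc_length_curve_def by (auto simp: curve_length_shift image_subset_iff)

text \<open>
  For Borel \<open>g\<close> the lower integral along a curve is a genuine integral, so it is additive and obeys the
  convergence theorems. Cutting off outside the parameter interval matters because \<open>\<gamma>\<close> is arbitrary there.
\<close>

lemma curve_measurable: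
  fixes g :: "'a::metric_space \<Rightarrow> ennreal"
  assumes "arc_length_curve E \<gamma> l" and [measurable]: "g \<in> borel_measurable borel"
  shows "(\<lambda>t. g (\<gamma> t) * indicator {0..l} t) \<in> borel_measurable borel"
proof -
  have [measurable]: "\<gamma> \<in> borel_measurable (restrict_space borel {0..l})"
    using arc_length_curve_continuous[OF assms(1)] by (rule borel_measurable_continuous_on_restrict)
  have "(\<lambda>t. g (\<gamma> t)) \<in> borel_measurable (restrict_space borel {0..l})"
    by measurable
  then show ?thesis
    by (subst (asm) borel_measurable_restrict_space_iff_ennreal) auto
qed

lemma curve_integral_eq_lborel:
  "curve_integral g \<gamma> l = (\<integral>\<^sup>+t\<in>{0..l}. g (\<gamma> t) \<partial>lborel)"
  by (simp add: curve_integral_def nn_integral_completion)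

lemma curve_integral_mono:
  assumes "\<And>x. g x \<le> h x"
  shows "curve_integral g \<gamma> l \<le> curve_integral h \<gamma> l"
  unfolding curve_integral_def by (intro nn_integral_mono mult_right_mono assms) auto

lemma curve_integral_subcurve:
  fixes g :: "'a::metric_space \<Rightarrow> ennreal"
  assumes \<gamma>: "arc_length_curve E \<gamma> l" and g: "g \<in> borel_measurable borel"
    and st: "0 \<le> s" "s < t" "t \<le> l"
  shows "curve_integral g (\<lambda>x. \<gamma> (s + x)) (t - s) = (\<integral>\<^sup>+x\<in>{s..t}. g (\<gamma> x) * indicator {0..l} x \<partial>lborel)"
proof -
  have [measurable]: "(\<lambda>t. g (\<gamma> t) * indicator {0..l} t) \<in> borel_measurable borel"
    by (rule curve_measurable[OF \<gamma> g])
  have "(\<integral>\<^sup>+x\<in>{s..t}. g (\<gamma> x) * indicator {0..l} x \<partial>lborel)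
      = (\<integral>\<^sup>+x. g (\<gamma> (s + x)) * indicator {0..l} (s + x) * indicator {s..t} (s + x) \<partial>lborel)"
    by (subst nn_integral_real_affine[where c=1 and t=s]) auto
  also have "\<dots> = curve_integral g (\<lambda>x. \<gamma> (s + x)) (t - s)"
    unfolding curve_integral_eq_lborel
    by (intro nn_integral_cong) (use st in \<open>auto simp: indicator_def\<close>)
  finally show ?thesis ..
qed

section \<open>Properties of almost every curve\<close>

lemma nn_integral_restrict_UNIV [simp]: "nn_integral (restrict_space M UNIV) f = nn_integral M f"
  by (simp add: nn_integral_restrict_space)

lemma measurable_restrict_UNIV [simp]: "f \<in> borel_measurable (restrict_space M UNIV) \<longleftrightarrow> f \<in> borel_measurable M"
  by (intro arg_cong2[where f="(\<in>)"] measurable_cong_sets refl sets_restrict_UNIV)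

lemma ae_curve_UNIV_def:
  "ae_curve \<mu> p UNIV P \<longleftrightarrow> (\<exists>\<rho>\<in>borel_measurable borel. (\<integral>\<^sup>+x. epow (\<rho> x) p \<partial>\<mu>) < \<infinity> \<and>
    (\<forall>\<gamma> l. arc_length_curve UNIV \<gamma> l \<and> \<not> P \<gamma> l \<longrightarrow> curve_integral \<rho> \<gamma> l = \<infinity>))"
  unfolding ae_curve_def by (simp add: Bex_def)

lemma ae_curve_mono:
  assumes "ae_curve \<mu> p E P" "\<And>\<gamma> l. arc_length_curve E \<gamma> l \<Longrightarrow> P \<gamma> l \<Longrightarrow> Q \<gamma> l"
  shows "ae_curve \<mu> p E Q"
  using assms unfolding ae_curve_def by blast

text \<open>
  The exceptional weights are scaled so that the \<open>p\<close>-th powers have summable integrals. Their supremum is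
  then \<open>p\<close>-integrable, and it is infinite along every curve that is exceptional for some \<open>n\<close>.
\<close>

lemma ae_curve_all:
  assumes p: "0 < p" and id: "(\<lambda>x. x) \<in> measurable \<mu> borel"
    and P: "\<And>n::nat. ae_curve \<mu> p UNIV (P n)"
  shows "ae_curve \<mu> p UNIV (\<lambda>\<gamma> l. \<forall>n. P n \<gamma> l)"
proof -
  obtain \<rho> where \<rho>: "\<And>n. \<rho> n \<in> borel_measurable borel" "\<And>n. (\<integral>\<^sup>+x. epow (\<rho> n x) p \<partial>\<mu>) < \<infinity>"
     "\<And>n \<gamma> l. arc_length_curve UNIV \<gamma> l \<Longrightarrow> \<not> P n \<gamma> l \<Longrightarrow> curve_integral (\<rho> n) \<gamma> l = \<infinity>"
    using P unfolding ae_curve_UNIV_def Bex_def by metis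
  have [measurable]: "\<rho> n \<in> borel_measurable borel" "\<rho> n \<in> borel_measurable \<mu>" for n
    using \<rho>(1) measurable_compose[OF id \<rho>(1)] by auto
  have "\<exists>c>0. ennreal (c powr p) * (\<integral>\<^sup>+x. epow (\<rho> n x) p \<partial>\<mu>) \<le> ennreal ((1/2)^n)" for n
  proof -
    obtain A where A: "(\<integral>\<^sup>+x. epow (\<rho> n x) p \<partial>\<mu>) = ennreal A" "0 \<le> A"
      using \<rho>(2)[of n] by (cases "\<integral>\<^sup>+x. epow (\<rho> n x) p \<partial>\<mu>") auto
    \<comment> \<open>The factor makes the integral of the scaled power at most \<open>(1/2)^n\<close>; adding \<open>1\<close> avoids division by zero.\<close>
    define c where "c = ((1/2)^n / (A + 1)) powr (1/p)"
    have "c > 0" using A by (simp add: c_def)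
    moreover have "c powr p * A \<le> (1/2)^n"
    proof -
      have "c powr p * A = (1/2)^n * (A / (A + 1))"
        using p A by (simp add: c_def powr_powr)
      also have "\<dots> \<le> (1/2)^n"
        by (rule mult_left_le) (use A in auto)
      finally show ?thesis .
    qed
    ultimately show ?thesis
      using A by (intro exI[of _ c]) (auto simp flip: ennreal_mult intro!: ennreal_leI)
  qed
  then obtain c where c: "\<And>n. c n > 0"
      "\<And>n. ennreal (c n powr p) * (\<integral>\<^sup>+x. epow (\<rho> n x) p \<partial>\<mu>) \<le> ennreal ((1/2)^n)"
    by metis
  let ?\<rho> = "\<lambda>x. SUP n. ennreal (c n) * \<rho> n x"
  have "(\<integral>\<^sup>+x. epow (?\<rho> x) p \<partial>\<mu>) \<le> (\<integral>\<^sup>+x. (\<Sum>n. epow (ennreal (c n) * \<rho> n x) p) \<partial>\<mu>)"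
    by (intro nn_integral_mono epow_SUP_le_suminf p)
  also have "\<dots> = (\<Sum>n. \<integral>\<^sup>+x. epow (ennreal (c n) * \<rho> n x) p \<partial>\<mu>)"
    by (rule nn_integral_suminf) measurable
  also have "\<dots> = (\<Sum>n. ennreal (c n powr p) * (\<integral>\<^sup>+x. epow (\<rho> n x) p \<partial>\<mu>))"
    using c(1) by (simp add: epow_mult epow_ennreal less_imp_le nn_integral_cmult)
  also have "\<dots> \<le> (\<Sum>n. ennreal ((1/2)^n))"
    by (intro suminf_le c) auto
  also have "\<dots> < \<infinity>"
    by (subst suminf_ennreal2) (auto simp: summable_geometric)
  finally have fin: "(\<integral>\<^sup>+x. epow (?\<rho> x) p \<partial>\<mu>) < \<infinity>" .
  have "curve_integral ?\<rho> \<gamma> l = \<infinity>" if \<gamma>: "arc_length_curve UNIV \<gamma> l" and "\<not> P n \<gamma> l" for n \<gamma> l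
  proof -
    have [measurable]: "(\<lambda>t. \<rho> n (\<gamma> t) * indicator {0..l} t) \<in> borel_measurable borel"
      by (rule curve_measurable[OF \<gamma>]) measurable
    have "\<infinity> = ennreal (c n) * curve_integral (\<rho> n) \<gamma> l"
      using \<rho>(3)[OF that] c(1)[of n] by (simp add: ennreal_mult_top)
    also have "\<dots> = (\<integral>\<^sup>+t. ennreal (c n) * (\<rho> n (\<gamma> t) * indicator {0..l} t) \<partial>lborel)"
      unfolding curve_integral_eq_lborel by (rule nn_integral_cmult[symmetric]) simp
    also have "\<dots> = curve_integral (\<lambda>x. ennreal (c n) * \<rho> n x) \<gamma> l"
      unfolding curve_integral_eq_lborel by (simp add: mult.assoc)
    also have "\<dots> \<le> curve_integral ?\<rho> \<gamma> l"
      by (intro curve_integral_mono SUP_upper) simp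
    finally show ?thesis by (simp add: top_unique)
  qed
  then show ?thesis
    unfolding ae_curve_UNIV_def using fin by (intro bexI[of _ ?\<rho>]) auto
qed

lemma ae_curve_conj:
  assumes "0 < p" "(\<lambda>x. x) \<in> measurable \<mu> borel"
    and "ae_curve \<mu> p UNIV P" "ae_curve \<mu> p UNIV Q"
  shows "ae_curve \<mu> p UNIV (\<lambda>\<gamma> l. P \<gamma> l \<and> Q \<gamma> l)"
proof -
  have "ae_curve \<mu> p UNIV (\<lambda>\<gamma> l. \<forall>n::nat. (if n = 0 then P else Q) \<gamma> l)"
    using assms by (intro ae_curve_all) auto
  then show ?thesis
    by (rule ae_curve_mono) (metis zero_neq_one)
qed

text \<open>
  The function itself is an admissible weight for the family of curves along which its integral is
  infinite.
\<close>

lemma ae_curve_finite_integral: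
  assumes "g \<in> borel_measurable borel" "(\<integral>\<^sup>+x. epow (g x) p \<partial>\<mu>) < \<infinity>"
  shows "ae_curve \<mu> p UNIV (\<lambda>\<gamma> l. curve_integral g \<gamma> l < \<infinity>)"
  unfolding ae_curve_UNIV_def using assms
  by (intro bexI[of _ g] conjI allI impI) (simp_all add: not_less top_unique)

text \<open>
  A weight whose integral is infinite along a subcurve has infinite integral along the whole curve.
\<close>

lemma ae_curve_subcurves:
  assumes "ae_curve \<mu> p UNIV P"
  shows "ae_curve \<mu> p UNIV (\<lambda>\<gamma> l. \<forall>s t. 0 \<le> s \<and> s < t \<and> t \<le> l \<longrightarrow> P (\<lambda>x. \<gamma> (s + x)) (t - s))"
proof -
  obtain \<rho> where \<rho>: "\<rho> \<in> borel_measurable borel" "(\<integral>\<^sup>+x. epow (\<rho> x) p \<partial>\<mu>) < \<infinity>"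
     "\<And>\<gamma> l. arc_length_curve UNIV \<gamma> l \<Longrightarrow> \<not> P \<gamma> l \<Longrightarrow> curve_integral \<rho> \<gamma> l = \<infinity>"
    using assms unfolding ae_curve_UNIV_def by blast
  have "curve_integral \<rho> \<gamma> l = \<infinity>" if \<gamma>: "arc_length_curve UNIV \<gamma> l"
    and st: "0 \<le> s" "s < t" "t \<le> l" and "\<not> P (\<lambda>x. \<gamma> (s + x)) (t - s)" for \<gamma> l s t
  proof -
    have "\<infinity> = curve_integral \<rho> (\<lambda>x. \<gamma> (s + x)) (t - s)"
      using \<rho>(3)[OF arc_length_curve_subcurve[OF \<gamma> st]] that by simp
    also have "\<dots> \<le> curve_integral \<rho> \<gamma> l"
      unfolding curve_integral_subcurve[OF \<gamma> \<rho>(1) st]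
      unfolding curve_integral_eq_lborel
      by (intro nn_integral_mono) (auto simp: indicator_def)
    finally show ?thesis by (simp add: top_unique)
  qed
  then show ?thesis
    unfolding ae_curve_UNIV_def using \<rho>(1,2) by (intro bexI[of _ \<rho>]) auto
qed

section \<open>Borel representatives\<close>

lemma metric_measure_space:
  assumes "metric_measure \<mu>"
  shows "space \<mu> = UNIV" "(\<lambda>x. x) \<in> measurable \<mu> borel"
proof -
  obtain \<nu> where \<nu>: "sets \<nu> = sets borel" "\<mu> = completion \<nu>"
    using assms unfolding metric_measure_def by blast
  have "space \<nu> = UNIV"
    using sets_eq_imp_space_eq[OF \<nu>(1)] by simp
  then show "space \<mu> = UNIV" by (simp add: \<nu>)
  have "(\<lambda>x. x) \<in> measurable \<nu> borel"
    using \<nu>(1) measurable_cong_sets[OF \<nu>(1) refl, of borel] by simp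
  then show "(\<lambda>x. x) \<in> measurable \<mu> borel"
    unfolding \<nu> by (rule measurable_completion)
qed

text \<open>
  Weak upper gradients are only measurable for the completed measure, and their values along a curve
  may be nonmeasurable. A Borel majorant that agrees almost everywhere is still a weak upper gradient and has
  the same energy.
\<close>

lemma metric_measure_Borel_majorant:
  fixes g :: "'a::metric_space \<Rightarrow> ennreal"
  assumes \<mu>: "metric_measure \<mu>" and g: "g \<in> borel_measurable \<mu>"
  obtains h where "h \<in> borel_measurable borel" "\<And>x. g x \<le> h x" "AE x in \<mu>. h x = g x"
proof -
  obtain \<nu> where \<nu>: "sets \<nu> = sets borel" "\<mu> = completion \<nu>"
    using \<mu> unfolding metric_measure_def by blast
  have eq: "measurable \<nu> M = measurable borel M" for M :: "ennreal measure"
    using \<nu>(1) by (rule measurable_cong_sets) simp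
  obtain g' where g': "g' \<in> borel_measurable \<nu>" and ae: "AE x in \<nu>. g x = g' x"
    using completion_ex_borel_measurable[OF g[unfolded \<nu>(2)]] by blast
  have "space \<nu> = UNIV"
    using sets_eq_imp_space_eq[OF \<nu>(1)] by simp
  then obtain N where N: "N \<in> null_sets \<nu>" "{x. g x \<noteq> g' x} \<subseteq> N"
    using ae by (auto elim!: AE_E simp: null_sets_def)
  have [measurable]: "N \<in> sets borel" "g' \<in> borel_measurable borel"
    using N(1) \<nu>(1) g' eq by auto
  let ?h = "\<lambda>x. if x \<in> N then \<infinity> else g' x"
  have "AE x in \<nu>. x \<notin> N" using N(1) by (rule AE_not_in)
  then have "AE x in \<mu>. x \<notin> N" unfolding \<nu>(2) by (rule AE_completion)
  then have "AE x in \<mu>. ?h x = g x"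
    by eventually_elim (use N(2) in force)
  moreover have "?h \<in> borel_measurable borel" by measurable
  moreover have "g x \<le> ?h x" for x using N(2) by force
  ultimately show thesis using that by blast
qed

section \<open>Minima and decreasing limits of weak upper gradients\<close>

lemma weak_upper_gradient_real_iff:
  "weak_upper_gradient \<mu> p UNIV (\<lambda>x. ereal (u x)) g \<longleftrightarrow> g \<in> borel_measurable \<mu> \<and>
    ae_curve \<mu> p UNIV (\<lambda>\<gamma> l. ennreal \<bar>u (\<gamma> 0) - u (\<gamma> l)\<bar> \<le> curve_integral g \<gamma> l)"
  by (simp add: weak_upper_gradient_def e2ennreal_ereal)

lemma weak_upper_gradient_mono:
  assumes "weak_upper_gradient \<mu> p UNIV u g" "h \<in> borel_measurable \<mu>" "\<And>x. g x \<le> h x"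
  shows "weak_upper_gradient \<mu> p UNIV u h"
proof -
  have "curve_integral g \<gamma> l \<le> curve_integral h \<gamma> l" for \<gamma> l
    using assms(3) by (rule curve_integral_mono)
  then show ?thesis
    using assms(1,2) unfolding weak_upper_gradient_def
    by (intro conjI) (simp, elim conjE, erule ae_curve_mono, erule order_trans)
qed

text \<open>
  For almost every curve both functions control the increments of \<open>u\<close> over all subcurves, which is
  the hypothesis of the one-dimensional lemma for \<open>u \<circ> \<gamma>\<close>. Finiteness of the two curve integrals matters: a
  function whose integral is infinite on every subinterval gives no bound on increments, while its minimum with
  the other function may be too small to be a weak upper gradient.
\<close>

lemma weak_upper_gradient_min:
  fixes u :: "'a::metric_space \<Rightarrow> real"
  assumes p: "0 < p" and id: "(\<lambda>x. x) \<in> measurable \<mu> borel"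
    and g1: "g1 \<in> borel_measurable borel" "weak_upper_gradient \<mu> p UNIV (\<lambda>x. ereal (u x)) g1"
      "ae_curve \<mu> p UNIV (\<lambda>\<gamma> l. curve_integral g1 \<gamma> l < \<infinity>)"
    and g2: "g2 \<in> borel_measurable borel" "weak_upper_gradient \<mu> p UNIV (\<lambda>x. ereal (u x)) g2"
      "ae_curve \<mu> p UNIV (\<lambda>\<gamma> l. curve_integral g2 \<gamma> l < \<infinity>)"
  shows "weak_upper_gradient \<mu> p UNIV (\<lambda>x. ereal (u x)) (\<lambda>x. min (g1 x) (g2 x))"
proof -
  let ?P = "\<lambda>g \<gamma> l. ennreal \<bar>u (\<gamma> 0) - u (\<gamma> l)\<bar> \<le> curve_integral g \<gamma> l"
  let ?S = "\<lambda>g \<gamma> l. \<forall>s t. 0 \<le> s \<and> s < t \<and> t \<le> l \<longrightarrow> ?P g (\<lambda>x. \<gamma> (s + x)) (t - s)"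
  let ?F = "\<lambda>g \<gamma> l. curve_integral g \<gamma> l < \<infinity>"
  have "ae_curve \<mu> p UNIV (?P g1)" "ae_curve \<mu> p UNIV (?P g2)"
    using g1(2) g2(2) by (simp_all add: weak_upper_gradient_real_iff)
  note this[THEN ae_curve_subcurves]
  then have "ae_curve \<mu> p UNIV (\<lambda>\<gamma> l. (?S g1 \<gamma> l \<and> ?S g2 \<gamma> l) \<and> (?F g1 \<gamma> l \<and> ?F g2 \<gamma> l))"
    using g1(3) g2(3) by (intro ae_curve_conj p id)
  then have "ae_curve \<mu> p UNIV (?P (\<lambda>x. min (g1 x) (g2 x)))"
  proof (rule ae_curve_mono)
    fix \<gamma> :: "real \<Rightarrow> 'a" and l
    assume \<gamma>: "arc_length_curve UNIV \<gamma> l" and H: "(?S g1 \<gamma> l \<and> ?S g2 \<gamma> l) \<and> (?F g1 \<gamma> l \<and> ?F g2 \<gamma> l)"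
    have l: "0 \<le> l" using \<gamma> by (simp add: arc_length_curve_def)
    let ?g1 = "\<lambda>t. g1 (\<gamma> t) * indicator {0..l} t" and ?g2 = "\<lambda>t. g2 (\<gamma> t) * indicator {0..l} t"
    have *: "ennreal \<bar>u (\<gamma> t) - u (\<gamma> s)\<bar> \<le> (\<integral>\<^sup>+x\<in>{s..t}. g (\<gamma> x) * indicator {0..l} x \<partial>lborel)"
      if "g \<in> borel_measurable borel" "?S g \<gamma> l" "0 \<le> s" "s < t" "t \<le> l" for g s t
    proof -
      have "?P g (\<lambda>x. \<gamma> (s + x)) (t - s)" using that by blast
      then show ?thesis
        using curve_integral_subcurve[OF \<gamma> that(1,3,4,5)] by (simp add: abs_minus_commute)
    qed
    have "ennreal \<bar>u (\<gamma> l) - u (\<gamma> 0)\<bar> \<le> (\<integral>\<^sup>+x\<in>{0..l}. min (?g1 x) (?g2 x) \<partial>lborel)"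
      using H by (intro nn_integrals_bound_min[of 0 l _ _ "\<lambda>x. u (\<gamma> x)"] l curve_measurable[OF \<gamma>] * g1(1) g2(1))
        (auto simp: curve_integral_eq_lborel)
    also have "\<dots> = curve_integral (\<lambda>x. min (g1 x) (g2 x)) \<gamma> l"
      unfolding curve_integral_eq_lborel by (intro nn_integral_cong) (auto simp: indicator_def)
    finally show "?P (\<lambda>x. min (g1 x) (g2 x)) \<gamma> l" by (simp add: abs_minus_commute)
  qed
  moreover have "g1 \<in> borel_measurable \<mu>" "g2 \<in> borel_measurable \<mu>"
    using g1(2) g2(2) by (auto simp: weak_upper_gradient_def)
  ultimately show ?thesis
    by (auto simp: weak_upper_gradient_real_iff)
qed

text \<open>
  Monotone convergence from above holds along every curve on which the first integral is finite.
\<close>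

lemma weak_upper_gradient_INF:
  fixes u :: "'a::metric_space \<Rightarrow> real" and g :: "nat \<Rightarrow> 'a \<Rightarrow> ennreal"
  assumes p: "0 < p" and id: "(\<lambda>x. x) \<in> measurable \<mu> borel"
    and g: "\<And>n. g n \<in> borel_measurable borel" "\<And>n. weak_upper_gradient \<mu> p UNIV (\<lambda>x. ereal (u x)) (g n)"
    and dec: "decseq g"
    and fin: "ae_curve \<mu> p UNIV (\<lambda>\<gamma> l. curve_integral (g 0) \<gamma> l < \<infinity>)"
  shows "weak_upper_gradient \<mu> p UNIV (\<lambda>x. ereal (u x)) (\<lambda>x. INF n. g n x)"
proof -
  let ?P = "\<lambda>g \<gamma> l. ennreal \<bar>u (\<gamma> 0) - u (\<gamma> l)\<bar> \<le> curve_integral g \<gamma> l"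
  have "ae_curve \<mu> p UNIV (\<lambda>\<gamma> l. (\<forall>n. ?P (g n) \<gamma> l) \<and> curve_integral (g 0) \<gamma> l < \<infinity>)"
    using g(2) fin by (intro ae_curve_conj ae_curve_all p id) (auto simp: weak_upper_gradient_real_iff)
  then have "ae_curve \<mu> p UNIV (?P (\<lambda>x. INF n. g n x))"
  proof (rule ae_curve_mono)
    fix \<gamma> :: "real \<Rightarrow> 'a" and l
    assume \<gamma>: "arc_length_curve UNIV \<gamma> l" and H: "(\<forall>n. ?P (g n) \<gamma> l) \<and> curve_integral (g 0) \<gamma> l < \<infinity>"
    let ?f = "\<lambda>n t. g n (\<gamma> t) * indicator {0..l} t"
    have "curve_integral (\<lambda>x. INF n. g n x) \<gamma> l = (\<integral>\<^sup>+t. (INF n. ?f n t) \<partial>lborel)"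
      unfolding curve_integral_eq_lborel by (intro nn_integral_cong) (auto simp: indicator_def)
    also have "\<dots> = (INF n. \<integral>\<^sup>+t. ?f n t \<partial>lborel)"
    proof (rule nn_integral_monotone_convergence_INF_decseq[where i=0])
      show "decseq ?f"
        by (intro decseq_SucI le_funI mult_right_mono decseq_SucD[OF dec, THEN le_funD]) auto
      show "?f i \<in> borel_measurable lborel" for i
        using curve_measurable[OF \<gamma> g(1)] by simp
      show "(\<integral>\<^sup>+t. ?f 0 t \<partial>lborel) < \<infinity>"
        using H by (simp add: curve_integral_eq_lborel)
    qed
    also have "\<dots> = (INF n. curve_integral (g n) \<gamma> l)"
      by (simp add: curve_integral_eq_lborel)
    finally show "?P (\<lambda>x. INF n. g n x) \<gamma> l"
      using H by (auto intro: INF_greatest)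
  qed
  moreover have "g n \<in> borel_measurable \<mu>" for n
    using g(2) by (auto simp: weak_upper_gradient_def)
  ultimately show ?thesis
    by (auto simp: weak_upper_gradient_real_iff)
qed

section \<open>Separability and locally integrable functions\<close>

text \<open>
  The balls of radius \<open>e/2\<close> around the points of \<open>S\<close> are disjoint and have positive measure, and a
  summable family has only countably many nonzero terms.
\<close>

lemma finite_measure_countable_separated:
  fixes \<mu> :: "'a::metric_space measure" and S :: "'a set"
  assumes "finite_measure \<mu>" and balls: "\<And>x r. 0 < r \<Longrightarrow> ball x r \<in> sets \<mu> \<and> 0 < emeasure \<mu> (ball x r)"
    and "0 < e" and sep: "\<And>x y. x \<in> S \<Longrightarrow> y \<in> S \<Longrightarrow> x \<noteq> y \<Longrightarrow> e \<le> dist x y"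
  shows "countable S"
proof -
  interpret finite_measure \<mu> by fact
  let ?m = "\<lambda>x. measure \<mu> (ball x (e/2))"
  have pos: "0 < ?m x" for x
    using balls[of "e/2" x] \<open>0 < e\<close> by (simp add: emeasure_eq_measure)
  have "sum ?m F \<le> measure \<mu> (space \<mu>)" if F: "finite F" "F \<subseteq> S" for F
  proof -
    have "disjoint_family_on (\<lambda>x. ball x (e/2)) F"
      unfolding disjoint_family_on_def
    proof safe
      fix x y z assume xy: "x \<in> F" "y \<in> F" "x \<noteq> y" and z: "z \<in> ball x (e/2)" "z \<in> ball y (e/2)"
      have "dist x y \<le> dist x z + dist y z" by (metis dist_commute dist_triangle)
      then show "z \<in> {}" using sep[of x y] xy F z by auto
    qed
    then have "sum ?m F = measure \<mu> (\<Union>x\<in>F. ball x (e/2))"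
      using F balls \<open>0 < e\<close> by (intro finite_measure_finite_Union[symmetric]) auto
    also have "\<dots> \<le> measure \<mu> (space \<mu>)" by (rule bounded_measure)
    finally show ?thesis .
  qed
  then have "?m summable_on S"
    by (intro nonneg_bdd_above_summable_on) (auto intro!: bdd_aboveI2)
  then have "countable {x\<in>S. ?m x \<noteq> 0}" by (rule summable_countable_real)
  then show ?thesis using pos by (simp add: less_imp_neq[THEN not_sym])
qed

lemma ex_maximal_separated_set:
  fixes e :: real
  shows "\<exists>S :: 'a::metric_space set. (\<forall>x\<in>S. \<forall>y\<in>S. x \<noteq> y \<longrightarrow> e \<le> dist x y) \<and>
    (\<forall>x. \<exists>y\<in>S. x = y \<or> dist x y < e)"
proof -
  let ?A = "{S :: 'a set. \<forall>x\<in>S. \<forall>y\<in>S. x \<noteq> y \<longrightarrow> e \<le> dist x y}"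
  have "\<exists>M\<in>?A. \<forall>X\<in>?A. M \<subseteq> X \<longrightarrow> X = M"
  proof (rule subset_Zorn')
    fix C assume C: "subset.chain ?A C"
    then show "\<Union>C \<in> ?A"
      unfolding subset_chain_def by (simp add: subset_iff) (metis)
  qed
  then obtain S where S: "S \<in> ?A" and max: "\<forall>X\<in>?A. S \<subseteq> X \<longrightarrow> X = S" ..
  have "\<exists>y\<in>S. x = y \<or> dist x y < e" for x
  proof (rule ccontr)
    assume n: "\<not> ?thesis"
    then have ins: "insert x S \<in> ?A"
      using S(1) by (force simp: dist_commute not_less)
    have "insert x S = S" using bspec[OF max ins] by blast
    then show False using n by blast
  qed
  with S show ?thesis by blast
qed

text \<open>
  A maximal set of points at mutual distance at least \<open>e\<close> meets every ball of radius \<open>e\<close>, and it is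
  countable. The union over \<open>e = 1, 1/2, 1/3, \<dots>\<close> is dense.
\<close>

lemma finite_measure_countable_dense:
  fixes \<mu> :: "'a::metric_space measure"
  assumes "finite_measure \<mu>" "\<And>x r. 0 < r \<Longrightarrow> ball x r \<in> sets \<mu> \<and> 0 < emeasure \<mu> (ball x r)"
  obtains D :: "'a set" where "countable D" "\<And>x e. 0 < e \<Longrightarrow> \<exists>d\<in>D. dist x d < e"
proof -
  have "\<exists>S :: 'a set. countable S \<and> (\<forall>x. \<exists>y\<in>S. x = y \<or> dist x y < inverse (real (Suc n)))" for n
  proof -
    have e: "0 < inverse (real (Suc n))" by simp
    obtain S :: "'a set" where S: "\<forall>x\<in>S. \<forall>y\<in>S. x \<noteq> y \<longrightarrow> inverse (real (Suc n)) \<le> dist x y"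
      "\<forall>x. \<exists>y\<in>S. x = y \<or> dist x y < inverse (real (Suc n))"
      using ex_maximal_separated_set by blast
    have "countable S"
      by (rule finite_measure_countable_separated[OF assms e]) (use S(1) in auto)
    then show ?thesis using S(2) by blast
  qed
  then obtain S :: "nat \<Rightarrow> 'a set" where S: "\<And>n. countable (S n)"
    "\<And>n x. \<exists>y\<in>S n. x = y \<or> dist x y < inverse (real (Suc n))"
    by metis
  have "\<exists>d\<in>(\<Union>n. S n). dist x d < e" if e: "0 < e" for x e
  proof -
    obtain n where "inverse (real (Suc n)) < e"
      using reals_Archimedean[OF e] by blast
    then show ?thesis using S(2)[of n x] e by force
  qed
  moreover have "countable (\<Union>n. S n)" using S(1) by auto
  ultimately show thesis using that by blast
qed

text \<open>
  Balls with rational radii around the points of \<open>D\<close> on which \<open>h\<close> is \<open>p\<close>-integrable cover the space. On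
  each of them \<open>h\<close> has finite integral along almost every curve, and finitely many of them cover a compact
  curve.
\<close>

lemma ae_curve_finite_integral_Lp_loc:
  fixes \<mu> :: "'a::metric_space measure"
  assumes p: "0 < p" and id: "(\<lambda>x. x) \<in> measurable \<mu> borel"
    and D: "countable (D :: 'a set)" "\<And>x e. 0 < e \<Longrightarrow> \<exists>d\<in>D. dist x d < e"
    and h: "h \<in> borel_measurable borel" "h \<in> Lp_loc \<mu> p"
  shows "ae_curve \<mu> p UNIV (\<lambda>\<gamma> l. curve_integral h \<gamma> l < \<infinity>)"
proof -
  define \<U> where "\<U> = {U \<in> (\<lambda>(d, q). ball d (of_rat q)) ` (D \<times> UNIV). (\<integral>\<^sup>+y\<in>U. epow (h y) p \<partial>\<mu>) < \<infinity>}"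
  have "countable \<U>" unfolding \<U>_def using D(1) by (intro countable_subset[OF Collect_subset]) auto
  have op: "open U" if "U \<in> \<U>" for U using that by (auto simp: \<U>_def)
  have cover: "\<exists>U\<in>\<U>. x \<in> U" for x
  proof -
    obtain r where r: "0 < r" "(\<integral>\<^sup>+y\<in>ball x r. epow (h y) p \<partial>\<mu>) < \<infinity>"
      using h(2) by (auto simp: Lp_loc_def)
    obtain d where d: "d \<in> D" "dist x d < r / 3" using D(2)[of "r/3" x] r(1) by auto
    obtain q where q: "r / 3 < of_rat q" "of_rat q < r / 2" using of_rat_dense[of "r/3" "r/2"] r(1) by auto
    have sub: "ball d (of_rat q) \<subseteq> ball x r"
    proof
      fix y assume y: "y \<in> ball d (of_rat q)"
      have "dist x y \<le> dist x d + dist d y" by (rule dist_triangle)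
      then show "y \<in> ball x r" using y d(2) q(2) r(1) by auto
    qed
    have "(\<integral>\<^sup>+y\<in>ball d (of_rat q). epow (h y) p \<partial>\<mu>) \<le> (\<integral>\<^sup>+y\<in>ball x r. epow (h y) p \<partial>\<mu>)"
      using sub by (intro nn_integral_mono) (auto simp: indicator_def)
    then have "ball d (of_rat q) \<in> \<U>" using r(2) d(1) unfolding \<U>_def by force
    moreover have "x \<in> ball d (of_rat q)" using d(2) q(1) by (simp add: dist_commute)
    ultimately show ?thesis by blast
  qed
  have "\<U> \<noteq> {}" using cover by auto
  define U where "U = from_nat_into \<U>"
  have U: "range U = \<U>"
    unfolding U_def by (rule range_from_nat_into) fact+
  let ?h = "\<lambda>n x. h x * indicator (U n) x"
  have U_mem: "U n \<in> \<U>" for n using rangeI[of U n] unfolding U .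
  have [measurable]: "U n \<in> sets borel" for n by (rule borel_open[OF op[OF U_mem]])
  have h_meas: "?h n \<in> borel_measurable borel" for n using h(1) by measurable
  have "ae_curve \<mu> p UNIV (\<lambda>\<gamma> l. curve_integral (?h n) \<gamma> l < \<infinity>)" for n
  proof (rule ae_curve_finite_integral)
    show "?h n \<in> borel_measurable borel" by (rule h_meas)
    have "(\<integral>\<^sup>+x. epow (?h n x) p \<partial>\<mu>) = (\<integral>\<^sup>+y\<in>U n. epow (h y) p \<partial>\<mu>)"
      by (intro nn_integral_cong) (auto simp: indicator_def)
    then show "(\<integral>\<^sup>+x. epow (?h n x) p \<partial>\<mu>) < \<infinity>" using U_mem[of n] by (simp add: \<U>_def)
  qed
  then have "ae_curve \<mu> p UNIV (\<lambda>\<gamma> l. \<forall>n. curve_integral (?h n) \<gamma> l < \<infinity>)"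
    by (intro ae_curve_all p id)
  then show ?thesis
  proof (rule ae_curve_mono)
    fix \<gamma> :: "real \<Rightarrow> 'a" and l
    assume \<gamma>: "arc_length_curve UNIV \<gamma> l" and H: "\<forall>n. curve_integral (?h n) \<gamma> l < \<infinity>"
    have "compact (\<gamma> ` {0..l})"
      by (intro compact_continuous_image arc_length_curve_continuous[OF \<gamma>]) auto
    then obtain F where F: "finite F" "\<gamma> ` {0..l} \<subseteq> (\<Union>n\<in>F. U n)"
    proof (rule compactE_image)
      show "open (U n)" for n by (rule op[OF U_mem])
      show "\<gamma> ` {0..l} \<subseteq> (\<Union>n\<in>UNIV. U n)" using cover U by blast
    qed blast
    have "curve_integral h \<gamma> l \<le> (\<integral>\<^sup>+t. (\<Sum>n\<in>F. ?h n (\<gamma> t) * indicator {0..l} t) \<partial>lborel)"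
      unfolding curve_integral_eq_lborel
    proof (rule nn_integral_mono)
      fix t
      show "h (\<gamma> t) * indicator {0..l} t \<le> (\<Sum>n\<in>F. ?h n (\<gamma> t) * indicator {0..l} t)"
      proof (cases "t \<in> {0..l}")
        case True
        then obtain n where "n \<in> F" "\<gamma> t \<in> U n" using F(2) by blast
        then show ?thesis
          using member_le_sum[of n F "\<lambda>n. ?h n (\<gamma> t) * indicator {0..l} t"] F(1) by simp
      qed simp
    qed
    also have "\<dots> = (\<Sum>n\<in>F. curve_integral (?h n) \<gamma> l)"
      unfolding curve_integral_eq_lborel
      by (intro nn_integral_sum) (use curve_measurable[OF \<gamma> h_meas] in simp)
    also have "\<dots> < \<infinity>" using H F(1) by simp
    finally show "curve_integral h \<gamma> l < \<infinity>" .
  qed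
qed

section \<open>Minimal weak upper gradients\<close>

text \<open>
  The minimizer of the energy among Borel weak upper gradients is the smallest one: replacing it by its minimum
  with a competitor cannot lower the energy, so it lies below the competitor almost everywhere.
\<close>

lemma ex_minimal_weak_upper_gradient:
  fixes \<mu> :: "'a::metric_space measure" and u :: "'a \<Rightarrow> real"
  assumes p: "0 < p" and \<mu>: "metric_measure \<mu>" "finite_measure \<mu>"
    and g0: "weak_upper_gradient \<mu> p UNIV (\<lambda>x. ereal (u x)) g0" "(\<integral>\<^sup>+x. epow (g0 x) p \<partial>\<mu>) < \<infinity>"
  shows "\<exists>g. is_minimal_weak_upper_gradient \<mu> p (\<lambda>x. ereal (u x)) g"
proof -
  note id = metric_measure_space(2)[OF \<mu>(1)]
  have borel_imp: "f \<in> borel_measurable \<mu>" if "f \<in> borel_measurable borel" for f :: "'a \<Rightarrow> ennreal"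
    using measurable_compose[OF id that] by simp
  let ?wug = "weak_upper_gradient \<mu> p UNIV (\<lambda>x. ereal (u x))"
  let ?E = "\<lambda>g. \<integral>\<^sup>+x. epow (g x) p \<partial>\<mu>"
  define W where "W = {g \<in> borel_measurable borel. ?wug g \<and> ?E g < \<infinity>}"
  have fin: "ae_curve \<mu> p UNIV (\<lambda>\<gamma> l. curve_integral g \<gamma> l < \<infinity>)" if "g \<in> W" for g
    using that by (intro ae_curve_finite_integral) (auto simp: W_def)
  have W_min: "(\<lambda>x. min (g x) (k x)) \<in> W"
    if g: "g \<in> W" and k: "k \<in> borel_measurable borel" "?wug k"
      "ae_curve \<mu> p UNIV (\<lambda>\<gamma> l. curve_integral k \<gamma> l < \<infinity>)" for g k
  proof -
    have "?wug (\<lambda>x. min (g x) (k x))"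
      using g by (intro weak_upper_gradient_min p id k fin) (auto simp: W_def)
    moreover have "?E (\<lambda>x. min (g x) (k x)) \<le> ?E g"
      using p by (intro nn_integral_mono epow_mono) auto
    moreover have "(\<lambda>x. min (g x) (k x)) \<in> borel_measurable borel"
      using g k(1) unfolding W_def by (intro borel_measurable_min) auto
    ultimately show ?thesis using g by (auto simp: W_def)
  qed
  have "g0 \<in> borel_measurable \<mu>" using g0(1) by (simp add: weak_upper_gradient_def)
  then obtain k0 where k0: "k0 \<in> borel_measurable borel" "\<And>x. g0 x \<le> k0 x" "AE x in \<mu>. k0 x = g0 x"
    using metric_measure_Borel_majorant[OF \<mu>(1)] by blast
  have "?E k0 = ?E g0"
    by (rule nn_integral_cong_AE) (use k0(3) in eventually_elim, simp)
  then have "k0 \<in> W"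
    using weak_upper_gradient_mono[OF g0(1) borel_imp[OF k0(1)] k0(2)] k0(1) g0(2) by (simp add: W_def)
  then have ne: "?E ` W \<noteq> {}" by blast
  obtain f :: "nat \<Rightarrow> ennreal" where f: "range f \<subseteq> ?E ` W" "Inf (?E ` W) = (INF n. f n)"
    using ennreal_Inf_countable_INF[OF ne] by blast
  have "\<forall>n. \<exists>h\<in>W. f n = ?E h" using f(1) by blast
  then obtain h where h: "\<And>n. h n \<in> W" "\<And>n. f n = ?E (h n)" by metis
  \<comment> \<open>Running minima turn the minimizing sequence into a decreasing one.\<close>
  define g where "g = rec_nat (h 0) (\<lambda>n k x. min (k x) (h (Suc n) x))"
  have g_Suc: "g (Suc n) = (\<lambda>x. min (g n x) (h (Suc n) x))" and g_0: "g 0 = h 0" for n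
    by (simp_all add: g_def)
  have gW: "g n \<in> W" for n
  proof (induction n)
    case (Suc n)
    then show ?case
      unfolding g_Suc using h(1)[of "Suc n"] fin[OF h(1)] by (intro W_min) (auto simp: W_def)
  qed (simp add: g_0 h)
  have dec: "decseq g"
    by (intro decseq_SucI le_funI) (simp add: g_Suc)
  have gh: "g n x \<le> h n x" for n x
    by (cases n) (simp_all add: g_0 g_Suc)
  define G where "G = (\<lambda>x. INF n. g n x)"
  have [measurable]: "g n \<in> borel_measurable borel" for n using gW by (auto simp: W_def)
  have G_borel: "G \<in> borel_measurable borel" unfolding G_def by measurable
  have G_wug: "?wug G"
    unfolding G_def using gW fin by (intro weak_upper_gradient_INF p id dec) (auto simp: W_def)
  have "?E G \<le> f n" for n
  proof -
    have "G x \<le> h n x" for x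
      unfolding G_def by (rule INF_lower2[of n]) (simp_all add: gh)
    then show ?thesis
      unfolding h(2) using p by (intro nn_integral_mono epow_mono) auto
  qed
  then have G_Inf: "?E G \<le> Inf (?E ` W)"
    unfolding f(2) by (rule INF_greatest)
  also have "\<dots> \<le> ?E k0" using \<open>k0 \<in> W\<close> by (rule INF_lower)
  also have "\<dots> < \<infinity>" using \<open>k0 \<in> W\<close> by (simp add: W_def)
  finally have G_fin: "?E G < \<infinity>" .
  have GW: "G \<in> W" using G_borel G_wug G_fin by (simp add: W_def)
  have "(\<integral>\<^sup>+y\<in>ball x 1. epow (G y) p \<partial>\<mu>) < \<infinity>" for x
    by (rule le_less_trans[OF _ G_fin]) (auto intro!: nn_integral_mono simp: indicator_def)
  then have G_loc: "G \<in> Lp_loc \<mu> p"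
    unfolding Lp_loc_def using borel_imp[OF G_borel] by (auto intro!: exI[of _ 1])
  have balls: "ball x r \<in> sets \<mu> \<and> 0 < emeasure \<mu> (ball x r)" if "0 < r" for x :: 'a and r
    using \<mu>(1) that measurable_sets[OF id, of "ball x r"] metric_measure_space(1)[OF \<mu>(1)]
    by (auto simp: metric_measure_def)
  obtain D :: "'a set" where D: "countable D" "\<And>x e. 0 < e \<Longrightarrow> \<exists>d\<in>D. dist x d < e"
    using finite_measure_countable_dense[OF \<mu>(2) balls] by blast
  have "AE x in \<mu>. G x \<le> k x" if k: "?wug k" "k \<in> Lp_loc \<mu> p" for k
  proof -
    have k_meas: "k \<in> borel_measurable \<mu>" using k(2) by (simp add: Lp_loc_def)
    obtain k' where k': "k' \<in> borel_measurable borel" "\<And>x. k x \<le> k' x" "AE x in \<mu>. k' x = k x"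
      using metric_measure_Borel_majorant[OF \<mu>(1) k_meas] by blast
    have "(\<integral>\<^sup>+y\<in>A. epow (k' y) p \<partial>\<mu>) = (\<integral>\<^sup>+y\<in>A. epow (k y) p \<partial>\<mu>)" for A
      by (rule nn_integral_cong_AE) (use k'(3) in eventually_elim, simp)
    then have "k' \<in> Lp_loc \<mu> p"
      using k(2) borel_imp[OF k'(1)] by (simp add: Lp_loc_def)
    then have "ae_curve \<mu> p UNIV (\<lambda>\<gamma> l. curve_integral k' \<gamma> l < \<infinity>)"
      by (intro ae_curve_finite_integral_Lp_loc[OF p id D(1) _ k'(1)] D(2))
    then have mW: "(\<lambda>x. min (G x) (k' x)) \<in> W"
      using weak_upper_gradient_mono[OF k(1) borel_imp[OF k'(1)] k'(2)] by (intro W_min GW k'(1))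
    let ?m = "\<lambda>x. min (G x) (k' x)"
    have [measurable]: "G \<in> borel_measurable \<mu>" "k' \<in> borel_measurable \<mu>"
      using borel_imp[OF G_borel] borel_imp[OF k'(1)] .
    have EG: "?E G \<le> ?E ?m"
      using G_Inf INF_lower[OF mW, of ?E] by (rule order_trans)
    have m_fin: "?E ?m \<noteq> \<infinity>" using mW by (simp add: W_def less_top)
    have m_le: "AE x in \<mu>. epow (?m x) p \<le> epow (G x) p"
      using p by (intro AE_I2 epow_mono) simp_all
    have "AE x in \<mu>. epow (G x) p \<le> epow (?m x) p"
    proof (rule ccontr)
      assume n: "\<not> ?thesis"
      have "?E ?m < ?E G"
        by (rule nn_integral_less[OF _ _ m_fin m_le n]) measurable
      then show False using EG by simp
    qed
    then show ?thesis
      using k'(3) by eventually_elim (simp add: epow_le_iff[OF p])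
  qed
  then show ?thesis
    using G_wug G_loc unfolding is_minimal_weak_upper_gradient_def by blast
qed

lemma is_minimal_minimal_weak_upper_gradient:
  assumes "is_minimal_weak_upper_gradient \<mu> p u g"
  shows "is_minimal_weak_upper_gradient \<mu> p u (minimal_weak_upper_gradient \<mu> p u)"
  unfolding minimal_weak_upper_gradient_def by (rule someI[where P="is_minimal_weak_upper_gradient \<mu> p u", OF assms])

section \<open>Quasiminimizers on bounded spaces\<close>

lemma weak_upper_gradient_const: "weak_upper_gradient \<mu> p UNIV (\<lambda>x. ereal c) (\<lambda>x. 0)"
  unfolding weak_upper_gradient_real_iff[of _ _ "\<lambda>x. c"] ae_curve_UNIV_def
  by (intro conjI bexI[of _ "\<lambda>x. 0"]) simp_all

lemma minimal_weak_upper_gradient_const: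
  "AE x in \<mu>. minimal_weak_upper_gradient \<mu> p (\<lambda>x. ereal c) x = 0"
proof -
  have "(\<lambda>x. 0) \<in> Lp_loc \<mu> p"
    by (auto simp: Lp_loc_def intro: exI[of _ 1])
  then have 0: "is_minimal_weak_upper_gradient \<mu> p (\<lambda>x. ereal c) (\<lambda>x. 0)"
    using weak_upper_gradient_const by (simp add: is_minimal_weak_upper_gradient_def)
  from is_minimal_minimal_weak_upper_gradient[OF 0]
  have "AE x in \<mu>. minimal_weak_upper_gradient \<mu> p (\<lambda>x. ereal c) x \<le> 0"
    using 0 unfolding is_minimal_weak_upper_gradient_def by blast
  then show ?thesis by simp
qed

lemma newton_space_realD:
  assumes "(\<lambda>x. ereal (u x)) \<in> newton_space \<mu> p UNIV"
  obtains g where "weak_upper_gradient \<mu> p UNIV (\<lambda>x. ereal (u x)) g" "(\<integral>\<^sup>+x. epow (g x) p \<partial>\<mu>) < \<infinity>"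
    and "(\<integral>\<^sup>+x. epow (ennreal \<bar>u x\<bar>) p \<partial>\<mu>) < \<infinity>"
proof -
  let ?A = "\<integral>\<^sup>+x. epow (ennreal \<bar>u x\<bar>) p \<partial>\<mu>"
  let ?I = "INF g \<in> {g. weak_upper_gradient \<mu> p UNIV (\<lambda>x. ereal (u x)) g}. \<integral>\<^sup>+x. epow (g x) p \<partial>\<mu>"
  have "newton_norm \<mu> p UNIV (\<lambda>x. ereal (u x)) < \<infinity>"
    using assms by (simp add: newton_space_def)
  then have "?A + ?I < \<infinity>"
    by (simp add: newton_norm_def epow_less_top_iff e2ennreal_ereal)
  then have "?A < \<infinity>" "?I < \<infinity>" by simp_all
  from this(2) obtain g where "weak_upper_gradient \<mu> p UNIV (\<lambda>x. ereal (u x)) g" "(\<integral>\<^sup>+x. epow (g x) p \<partial>\<mu>) < \<infinity>"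
    unfolding INF_less_iff by blast
  then show thesis using \<open>?A < \<infinity>\<close> by (rule that)
qed

lemma newton_space_realI:
  assumes "u \<in> borel_measurable \<mu>" and "(\<integral>\<^sup>+x. epow (ennreal \<bar>u x\<bar>) p \<partial>\<mu>) < \<infinity>"
    and "weak_upper_gradient \<mu> p UNIV (\<lambda>x. ereal (u x)) g" "(\<integral>\<^sup>+x. epow (g x) p \<partial>\<mu>) < \<infinity>"
  shows "(\<lambda>x. ereal (u x)) \<in> newton_space \<mu> p UNIV"
proof -
  let ?I = "INF g \<in> {g. weak_upper_gradient \<mu> p UNIV (\<lambda>x. ereal (u x)) g}. \<integral>\<^sup>+x. epow (g x) p \<partial>\<mu>"
  have "?I \<le> (\<integral>\<^sup>+x. epow (g x) p \<partial>\<mu>)"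
    using assms(3) by (intro INF_lower) simp
  then have "?I < \<infinity>" using assms(4) by (rule le_less_trans)
  then show ?thesis
    using assms(1,2) by (simp add: newton_space_def newton_norm_def epow_less_top_iff e2ennreal_ereal)
qed

lemma newton_norm_zero: "newton_norm \<mu> p UNIV (\<lambda>x. ereal 0) = 0"
proof -
  let ?I = "INF g \<in> {g. weak_upper_gradient \<mu> p UNIV (\<lambda>x. ereal 0) g}. \<integral>\<^sup>+x. epow (g x) p \<partial>\<mu>"
  have "?I \<le> (\<integral>\<^sup>+x. epow 0 p \<partial>\<mu>)"
    using weak_upper_gradient_const by (intro INF_lower) simp
  then have "?I = 0" by simp
  then show ?thesis by (simp add: newton_norm_def)
qed

text \<open>
  Used to show that \<open>c - u\<close> is \<open>p\<close>-integrable when \<open>u\<close> is and the measure is finite.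
\<close>

lemma epow_abs_diff_le:
  assumes "0 < p"
  shows "epow (ennreal \<bar>c - x\<bar>) p \<le> ennreal (2 powr p) * (ennreal (\<bar>c\<bar> powr p) + epow (ennreal \<bar>x\<bar>) p)"
proof -
  have "\<bar>c - x\<bar> powr p \<le> (2 * max \<bar>c\<bar> \<bar>x\<bar>) powr p"
    using assms by (intro powr_mono2) auto
  also have "\<dots> = 2 powr p * max \<bar>c\<bar> \<bar>x\<bar> powr p"
    by (intro powr_mult)
  also have "\<dots> \<le> 2 powr p * (\<bar>c\<bar> powr p + \<bar>x\<bar> powr p)"
    by (intro mult_left_mono) (auto simp: max_def)
  finally have "ennreal (\<bar>c - x\<bar> powr p) \<le> ennreal (2 powr p * (\<bar>c\<bar> powr p + \<bar>x\<bar> powr p))"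
    by (rule ennreal_leI)
  then show ?thesis by (simp add: epow_ennreal ennreal_mult)
qed

text \<open>
  The whole space is a bounded open set, so \<open>v\<close> is approximated by itself.
\<close>

lemma bounded_imp_test_function:
  fixes v :: "'a::metric_space \<Rightarrow> real"
  assumes "bounded (UNIV :: 'a set)" "(\<lambda>x. ereal (v x)) \<in> newton_space \<mu> p UNIV"
  shows "(\<lambda>x. ereal (v x)) \<in> test_functions \<mu> p"
proof -
  have "(\<lambda>x. ereal (v x)) \<in> bounded_support_newton \<mu> p"
    using assms by (auto simp: bounded_support_newton_def intro!: exI[of _ UNIV])
  moreover have "newton_norm \<mu> p UNIV (\<lambda>x. ereal (v x) - ereal (v x)) < ennreal \<epsilon>" if "0 < \<epsilon>" for \<epsilon>
    using that newton_norm_zero[of \<mu> p] by (simp add: zero_ereal_def)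
  ultimately have "\<forall>\<epsilon>>0. \<exists>\<psi>\<in>bounded_support_newton \<mu> p.
      newton_norm \<mu> p UNIV (\<lambda>x. ereal (v x) - \<psi> x) < ennreal \<epsilon>"
    by (intro allI impI bexI[of _ "\<lambda>x. ereal (v x)"])
  then show ?thesis
    using assms(2) by (simp add: test_functions_def)
qed

text \<open>
  The test function \<open>c - u\<close> turns \<open>u\<close> into the constant \<open>c\<close>, whose energy is zero.
\<close>

lemma quasiminimizer_gradient_zero:
  fixes \<mu> :: "'a::metric_space measure" and u :: "'a \<Rightarrow> real"
  assumes p: "0 < p" and \<mu>: "metric_measure \<mu>" "finite_measure \<mu>"
    and bdd: "bounded (UNIV :: 'a set)" and u: "u \<in> borel_measurable \<mu>"
    and qm: "quasiminimizer \<mu> p (\<lambda>x. ereal (u x))"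
  obtains g where "weak_upper_gradient \<mu> p UNIV (\<lambda>x. ereal (u x)) g" "AE x in \<mu>. g x = 0"
proof -
  define g where "g = minimal_weak_upper_gradient \<mu> p (\<lambda>x. ereal (u x))"
  have "(\<lambda>x. ereal (u x)) \<in> newton_space \<mu> p UNIV"
    using qm bdd by (simp add: quasiminimizer_def)
  then obtain g0 where g0: "weak_upper_gradient \<mu> p UNIV (\<lambda>x. ereal (u x)) g0"
      "(\<integral>\<^sup>+x. epow (g0 x) p \<partial>\<mu>) < \<infinity>"
    and up: "(\<integral>\<^sup>+x. epow (ennreal \<bar>u x\<bar>) p \<partial>\<mu>) < \<infinity>"
    by (rule newton_space_realD)
  obtain g1 where "is_minimal_weak_upper_gradient \<mu> p (\<lambda>x. ereal (u x)) g1"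
    using ex_minimal_weak_upper_gradient[OF p \<mu> g0] by blast
  then have g: "weak_upper_gradient \<mu> p UNIV (\<lambda>x. ereal (u x)) g"
    using is_minimal_minimal_weak_upper_gradient unfolding g_def is_minimal_weak_upper_gradient_def by blast
  then have g_meas [measurable]: "g \<in> borel_measurable \<mu>"
    by (simp add: weak_upper_gradient_def)
  obtain Q where Q: "\<And>\<phi>. \<phi> \<in> test_functions \<mu> p \<Longrightarrow>
      (\<integral>\<^sup>+x\<in>{x. \<phi> x \<noteq> 0}. epow (g x) p \<partial>\<mu>) \<le> ennreal Q * (\<integral>\<^sup>+x\<in>{x. \<phi> x \<noteq> 0}.
        epow (minimal_weak_upper_gradient \<mu> p (\<lambda>y. ereal (u y) + \<phi> y) x) p \<partial>\<mu>)"
    using qm unfolding quasiminimizer_def g_def by blast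
  note [measurable] = u
  have zero: "AE x in \<mu>. u x \<noteq> c \<longrightarrow> g x = 0" for c
  proof -
    let ?\<phi> = "\<lambda>x. ereal (c - u x)"
    have "(\<integral>\<^sup>+x. epow (ennreal \<bar>c - u x\<bar>) p \<partial>\<mu>)
        \<le> (\<integral>\<^sup>+x. ennreal (2 powr p) * (ennreal (\<bar>c\<bar> powr p) + epow (ennreal \<bar>u x\<bar>) p) \<partial>\<mu>)"
      by (intro nn_integral_mono epow_abs_diff_le p)
    also have "\<dots> = ennreal (2 powr p) * (ennreal (\<bar>c\<bar> powr p) * emeasure \<mu> (space \<mu>)
        + (\<integral>\<^sup>+x. epow (ennreal \<bar>u x\<bar>) p \<partial>\<mu>))"
      by (simp add: nn_integral_cmult nn_integral_add)
    also have "\<dots> < \<infinity>"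
      using up finite_measure.emeasure_finite[OF \<mu>(2), of "space \<mu>"]
      by (simp add: ennreal_mult_less_top less_top)
    finally have fin: "(\<integral>\<^sup>+x. epow (ennreal \<bar>c - u x\<bar>) p \<partial>\<mu>) < \<infinity>" .
    have "\<bar>c - u x - (c - u y)\<bar> = \<bar>u x - u y\<bar>" for x y by simp
    then have "weak_upper_gradient \<mu> p UNIV ?\<phi> g0"
      using g0(1) unfolding weak_upper_gradient_real_iff by simp
    then have "?\<phi> \<in> newton_space \<mu> p UNIV"
      using fin g0(2) by (intro newton_space_realI[where g=g0]) auto
    then have "?\<phi> \<in> test_functions \<mu> p"
      by (rule bounded_imp_test_function[OF bdd])
    note Q[OF this]
    also have "(\<integral>\<^sup>+x\<in>{x. ?\<phi> x \<noteq> 0}. epow (minimal_weak_upper_gradient \<mu> p (\<lambda>y. ereal (u y) + ?\<phi> y) x) p \<partial>\<mu>)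
        = (\<integral>\<^sup>+x. 0 \<partial>\<mu>)"
      by (rule nn_integral_cong_AE) (use minimal_weak_upper_gradient_const[of \<mu> p c] in eventually_elim, simp)
    finally have "(\<integral>\<^sup>+x\<in>{x. ?\<phi> x \<noteq> 0}. epow (g x) p \<partial>\<mu>) = 0" by simp
    moreover have "(\<integral>\<^sup>+x\<in>{x. ?\<phi> x \<noteq> 0}. epow (g x) p \<partial>\<mu>) = (\<integral>\<^sup>+x. (if u x = c then 0 else epow (g x) p) \<partial>\<mu>)"
      by (intro nn_integral_cong) (auto simp: indicator_def)
    ultimately have "(\<integral>\<^sup>+x. (if u x = c then 0 else epow (g x) p) \<partial>\<mu>) = 0" by simp
    then have "AE x in \<mu>. (if u x = c then 0 else epow (g x) p) = 0"
      by (subst (asm) nn_integral_0_iff_AE) measurable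
    then show ?thesis
      by eventually_elim (auto simp: epow_eq_0_iff split: if_splits)
  qed
  \<comment> \<open>A point with \<open>u x = 0\<close> has \<open>u x \<noteq> 1\<close>, so two constants reach every point.\<close>
  have "AE x in \<mu>. g x = 0"
    using zero[of 0] zero[of 1] by eventually_elim auto
  with g show thesis by (rule that)
qed

section \<open>Functions with zero gradient\<close>

text \<open>
  Curves in \<open>E\<close> are curves in the whole space, so the same exceptional weight works. The Poincare
  inequality on a ball asks for a weak upper gradient on that ball.
\<close>

lemma weak_upper_gradient_subset:
  assumes E: "E \<in> sets \<mu>" and g: "weak_upper_gradient \<mu> p UNIV u g"
  shows "weak_upper_gradient \<mu> p E u g"
proof -
  let ?P = "\<lambda>\<gamma> l. (if \<bar>u (\<gamma> 0)\<bar> = \<infinity> \<or> \<bar>u (\<gamma> l)\<bar> = \<infinity> then \<infinity> else e2ennreal \<bar>u (\<gamma> 0) - u (\<gamma> l)\<bar>)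
         \<le> curve_integral g \<gamma> l"
  obtain \<rho> where \<rho>: "\<rho> \<in> borel_measurable borel" "(\<integral>\<^sup>+x. epow (\<rho> x) p \<partial>\<mu>) < \<infinity>"
    "\<And>\<gamma> l. arc_length_curve UNIV \<gamma> l \<Longrightarrow> \<not> ?P \<gamma> l \<Longrightarrow> curve_integral \<rho> \<gamma> l = \<infinity>"
    using g unfolding weak_upper_gradient_def ae_curve_UNIV_def by blast
  have "(\<integral>\<^sup>+x. epow (\<rho> x) p \<partial>restrict_space \<mu> E) \<le> (\<integral>\<^sup>+x. epow (\<rho> x) p \<partial>\<mu>)"
    using E by (subst nn_integral_restrict_space) (auto intro!: nn_integral_mono simp: indicator_def)
  then have "(\<integral>\<^sup>+x. epow (\<rho> x) p \<partial>restrict_space \<mu> E) < \<infinity>"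
    using \<rho>(2) by (rule le_less_trans)
  moreover have "arc_length_curve UNIV \<gamma> l" if "arc_length_curve E \<gamma> l" for \<gamma> l
    using that by (simp add: arc_length_curve_def)
  ultimately have "ae_curve \<mu> p E ?P"
    unfolding ae_curve_def using \<rho>(1,3) by (intro exI[of _ \<rho>] conjI measurable_restrict_space1) blast+
  moreover have "g \<in> borel_measurable (restrict_space \<mu> E)"
    using g by (intro measurable_restrict_space1) (simp add: weak_upper_gradient_def)
  ultimately show ?thesis
    unfolding weak_upper_gradient_def by blast
qed
text \<open>
  A continuous function that differs from \<open>m\<close> somewhere differs from it on a whole ball, and balls are not
  null sets.
\<close>

lemma AE_eq_const_imp_eq_on_ball:
  fixes u :: "'a::metric_space \<Rightarrow> real"
  assumes \<mu>: "metric_measure \<mu>" and u: "continuous_on UNIV u"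
    and ae: "AE y in \<mu>. y \<in> ball x r \<longrightarrow> u y = m" and y: "y \<in> ball x r"
  shows "u y = m"
proof (rule ccontr)
  assume "u y \<noteq> m"
  have op: "open (ball x r \<inter> u -` (- {m}))"
    by (intro open_Int open_ball open_vimage u open_Compl closed_singleton)
  have "y \<in> ball x r \<inter> u -` (- {m})"
    using y \<open>u y \<noteq> m\<close> by simp
  from openE[OF op this] obtain s where s: "0 < s" "ball y s \<subseteq> ball x r \<inter> u -` (- {m})" .
  have "AE z in \<mu>. z \<notin> ball y s"
    using ae by eventually_elim (use s(2) in auto)
  moreover have "ball y s \<in> sets \<mu>"
    using measurable_sets[OF metric_measure_space(2)[OF \<mu>], of "ball y s"] metric_measure_space(1)[OF \<mu>] by simp
  ultimately have "ball y s \<in> null_sets \<mu>"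
    using AE_iff_null_sets by blast
  moreover have "0 < emeasure \<mu> (ball y s)"
    using \<mu> s(1) unfolding metric_measure_def by blast
  ultimately show False
    by (simp add: null_sets_def)
qed

text \<open>
  With a zero gradient the right-hand side of the Poincare inequality vanishes, so \<open>u\<close> equals its mean value
  almost everywhere on a small ball, hence everywhere on it by continuity.
\<close>

lemma local_Poincare_gradient_zero:
  fixes \<mu> :: "'a::metric_space measure" and u :: "'a \<Rightarrow> real"
  assumes \<mu>: "metric_measure \<mu>" and PI: "local_Poincare \<mu> p"
    and u: "continuous_on UNIV u"
    and g: "weak_upper_gradient \<mu> p UNIV (\<lambda>x. ereal (u x)) g" "AE x in \<mu>. g x = 0"
  shows "locally_constant u"
  unfolding locally_constant_def
proof
  fix x0
  have meas [measurable]: "ball x r \<in> sets \<mu>" for x r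
    using measurable_sets[OF metric_measure_space(2)[OF \<mu>], of "ball x r"] metric_measure_space(1)[OF \<mu>] by simp
  have u_meas [measurable]: "u \<in> borel_measurable \<mu>"
    using measurable_compose[OF metric_measure_space(2)[OF \<mu>] borel_measurable_continuous_onI[OF u]] by simp
  have ball_fin: "emeasure \<mu> (ball x r) < \<infinity>" if "0 < r" for x r
    using \<mu> that by (simp add: metric_measure_def)
  obtain r0 C \<Lambda> where P: "0 < r0" "1 \<le> \<Lambda>" and PI': "\<And>x r v g.
      0 < r \<Longrightarrow> ball x r \<subseteq> ball x0 r0 \<Longrightarrow> v \<in> borel_measurable (restrict_space \<mu> (ball x (\<Lambda> * r))) \<Longrightarrow>
        (\<integral>\<^sup>+y\<in>ball x (\<Lambda> * r). e2ennreal \<bar>v y\<bar> \<partial>\<mu>) < \<infinity> \<Longrightarrow>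
        weak_upper_gradient \<mu> p (ball x (\<Lambda> * r)) v g \<Longrightarrow>
        (\<integral>\<^sup>+y\<in>ball x r. e2ennreal \<bar>v y - ereal (mean_value \<mu> (ball x r) v)\<bar> \<partial>\<mu>)
            / emeasure \<mu> (ball x r)
          \<le> ennreal (C * r) *
            epow ((\<integral>\<^sup>+y\<in>ball x (\<Lambda> * r). epow (g y) p \<partial>\<mu>) / emeasure \<mu> (ball x (\<Lambda> * r))) (1 / p)"
    using PI[unfolded local_Poincare_def, THEN spec, of x0] by (elim exE conjE) blast
  obtain d where d: "0 < d" "\<And>y. dist y x0 < d \<Longrightarrow> dist (u y) (u x0) < 1"
    using u unfolding continuous_on_iff by (metis UNIV_I zero_less_one)
  \<comment> \<open>On the enlarged ball of radius \<open>\<Lambda> * r \<le> d\<close> the function is bounded by \<open>\<bar>u x0\<bar> + 1\<close>, hence integrable.\<close>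
  define r where "r = min r0 (d / \<Lambda>)"
  have r: "0 < r" "r \<le> r0" "\<Lambda> * r \<le> d" "0 < \<Lambda> * r"
    using P d(1) by (auto simp: r_def min_def field_simps)
  let ?v = "\<lambda>x. ereal (u x)"
  let ?m = "mean_value \<mu> (ball x0 r) ?v"
  have "(\<integral>\<^sup>+y\<in>ball x0 (\<Lambda> * r). e2ennreal \<bar>?v y\<bar> \<partial>\<mu>)
      \<le> (\<integral>\<^sup>+y. ennreal (\<bar>u x0\<bar> + 1) * indicator (ball x0 (\<Lambda> * r)) y \<partial>\<mu>)"
  proof (rule nn_integral_mono)
    fix y
    show "e2ennreal \<bar>?v y\<bar> * indicator (ball x0 (\<Lambda> * r)) y \<le> ennreal (\<bar>u x0\<bar> + 1) * indicator (ball x0 (\<Lambda> * r)) y"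
    proof (cases "y \<in> ball x0 (\<Lambda> * r)")
      case True
      then have "dist y x0 < d" using r(3) by (simp add: dist_commute)
      then have "\<bar>u y\<bar> \<le> \<bar>u x0\<bar> + 1" using d(2)[of y] by (simp add: dist_real_def)
      then show ?thesis using True by (simp add: e2ennreal_ereal ennreal_leI del: ennreal_plus)
    qed simp
  qed
  also have "\<dots> = ennreal (\<bar>u x0\<bar> + 1) * emeasure \<mu> (ball x0 (\<Lambda> * r))"
    by (rule nn_integral_cmult_indicator[OF meas])
  also have "\<dots> < \<infinity>"
    using ball_fin[OF r(4)] by (simp add: ennreal_mult_less_top)
  finally have fin: "(\<integral>\<^sup>+y\<in>ball x0 (\<Lambda> * r). e2ennreal \<bar>?v y\<bar> \<partial>\<mu>) < \<infinity>" .
  have "(\<integral>\<^sup>+y\<in>ball x0 (\<Lambda> * r). epow (g y) p \<partial>\<mu>) = (\<integral>\<^sup>+y. 0 \<partial>\<mu>)"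
    by (rule nn_integral_cong_AE) (use g(2) in eventually_elim, simp)
  then have g0: "(\<integral>\<^sup>+y\<in>ball x0 (\<Lambda> * r). epow (g y) p \<partial>\<mu>) = 0" by simp
  have "(\<integral>\<^sup>+y\<in>ball x0 r. e2ennreal \<bar>?v y - ereal ?m\<bar> \<partial>\<mu>) / emeasure \<mu> (ball x0 r)
      \<le> ennreal (C * r) *
        epow ((\<integral>\<^sup>+y\<in>ball x0 (\<Lambda> * r). epow (g y) p \<partial>\<mu>) / emeasure \<mu> (ball x0 (\<Lambda> * r))) (1 / p)"
    using r fin by (intro PI' weak_upper_gradient_subset[OF meas g(1)] measurable_restrict_space1) auto
  then have "(\<integral>\<^sup>+y\<in>ball x0 r. e2ennreal \<bar>?v y - ereal ?m\<bar> \<partial>\<mu>) / emeasure \<mu> (ball x0 r) = 0"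
    unfolding g0 by simp
  then have "(\<integral>\<^sup>+y. ennreal \<bar>u y - ?m\<bar> * indicator (ball x0 r) y \<partial>\<mu>) = 0"
    using ball_fin[OF r(1), of x0] by (auto simp: ennreal_divide_eq_0_iff e2ennreal_ereal)
  then have "AE y in \<mu>. ennreal \<bar>u y - ?m\<bar> * indicator (ball x0 r) y = 0"
    by (subst (asm) nn_integral_0_iff_AE) measurable
  then have "AE y in \<mu>. y \<in> ball x0 r \<longrightarrow> u y = ?m"
    by eventually_elim (auto simp: indicator_def split: if_splits)
  then have "u y = ?m" if "y \<in> ball x0 r" for y
    using that by (rule AE_eq_const_imp_eq_on_ball[OF \<mu> u])
  then show "\<exists>U. open U \<and> x0 \<in> U \<and> u constant_on U"
    using r(1) by (intro exI[of _ "ball x0 r"]) (auto simp: constant_on_def)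
qed

theorem proposition3p8:
  fixes \<mu> :: "'a::metric_space measure" and p :: real
  assumes "1 < p"
    and "metric_measure \<mu>"
    and "locally_doubling \<mu>"
    and "local_Poincare \<mu> p"
    and "bounded (UNIV :: 'a set)"
  shows "\<forall>u :: 'a \<Rightarrow> real. quasiharmonic \<mu> p u \<longrightarrow>
           locally_constant u \<and> (\<forall>K \<in> components (UNIV :: 'a set). u constant_on K)"
proof (intro allI impI)
  fix u :: "'a \<Rightarrow> real"
  assume "quasiharmonic \<mu> p u"
  then have u: "continuous_on UNIV u" and qm: "quasiminimizer \<mu> p (\<lambda>x. ereal (u x))"
    by (auto simp: quasiharmonic_def)
  have u_meas: "u \<in> borel_measurable \<mu>"
    using measurable_compose[OF metric_measure_space(2)[OF assms(2)] borel_measurable_continuous_onI[OF u]] by simp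
  obtain R :: real and a :: 'a where R: "0 < R" "UNIV = ball a R"
  proof -
    fix a :: 'a
    obtain e where "\<And>x. dist a x \<le> e"
      using assms(5) bounded_any_center[of UNIV a] by auto
    then have "UNIV = ball a (\<bar>e\<bar> + 1)"
      by (auto simp: intro!: le_less_trans[of "dist a _" e])
    then show thesis by (intro that[of "\<bar>e\<bar> + 1" a]) auto
  qed
  have "emeasure \<mu> (ball a R) < \<infinity>"
    using assms(2) R(1) by (simp add: metric_measure_def)
  then have "finite_measure \<mu>"
    using R(2) metric_measure_space(1)[OF assms(2)] by (intro finite_measureI) auto
  then obtain g where "weak_upper_gradient \<mu> p UNIV (\<lambda>x. ereal (u x)) g" "AE x in \<mu>. g x = 0"
    using assms(1) quasiminimizer_gradient_zero[OF _ assms(2) _ assms(5) u_meas qm] by auto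
  then have lc: "locally_constant u"
    by (rule local_Poincare_gradient_zero[OF assms(2,4) u])
  have "u constant_on K" if K: "K \<in> components UNIV" for K
  proof (rule locally_constant_imp_constant)
    show "connected K" using K by (rule in_components_connected)
    fix a assume "a \<in> K"
    obtain U where "open U" "a \<in> U" "u constant_on U"
      using lc unfolding locally_constant_def by blast
    then show "\<exists>T. openin (top_of_set K) T \<and> a \<in> T \<and> (\<forall>x\<in>T. u x = u a)"
      using \<open>a \<in> K\<close> by (intro exI[of _ "K \<inter> U"]) (auto simp: constant_on_def openin_open_Int)
  qed
  with lc show "locally_constant u \<and> (\<forall>K \<in> components (UNIV :: 'a set). u constant_on K)"
    by blast
qed

end
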